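(* Let $\mathcal{EL} = \{\mathcal{E}_{1}, \ldots, \mathcal{E}_{k},\ell_{1}, \ldots, \ell_{d}\}\subset \mathbb{P}^{2}_{\mathbb{C}}$ be an arrangement consisting of $k\geq 1$ smooth cubic curves and $d\geq 1$ lines whose union has as singularities only nodes ($A_1$), singularities of type $A_{5}$ (local normal form $x^2+y^6=0$), and ordinary triple points ($D_4$). If $\mathcal{EL}$ is free, then $3k+d \leq 9$.
   Context: The curves are pairwise distinct, so the union $C$ is a reduced plane curve of degree $m=3k+d$, defined by a reduced homogeneous polynomial $f\in S=\mathbb{C}[x,y,z]$ of degree $m$. Let $J_f$ be the Jacobian ideal generated by $\partial f/\partial x,\partial f/\partial y,\partial f/\partial z$, and let $\mathrm{Syz}(J_f)$ be the $S$-module of triples $(a,b,c)\in S^3$ with $a f_x+bf_y+cf_z=0$. The curve $C$ is called free if $\mathrm{Syz}(J_f)$ is minimally generated by two homogeneous syzygies of degrees $d_1\le d_2$ with $1\le d_1$ and $d_1+d_2=m-1$. The arrangement $\mathcal{EL}$ is called free if $C$ is free. *)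

theory Defs
  imports "HOL-Analysis.Analysis"
begin

text \<open>Points of C^3 (homogeneous coordinates of the projective plane).\<close>
type_synonym pt = "complex \<times> complex \<times> complex"

definition px :: "pt \<Rightarrow> complex" where "px v = fst v"
definition py :: "pt \<Rightarrow> complex" where "py v = fst (snd v)"
definition pz :: "pt \<Rightarrow> complex" where "pz v = snd (snd v)"

definition mono :: "nat \<times> nat \<times> nat \<Rightarrow> pt \<Rightarrow> complex" where
  "mono e v = px v ^ fst e * py v ^ fst (snd e) * pz v ^ snd (snd e)"

definition mdeg :: "nat \<times> nat \<times> nat \<Rightarrow> nat" where
  "mdeg e = fst e + fst (snd e) + snd (snd e)"

text \<open>Elements of S = C[x,y,z], represented by their (polynomial) functions on C^3
  (faithful since C is infinite).\<close>
definition poly3 :: "(pt \<Rightarrow> complex) \<Rightarrow> bool" where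
  "poly3 f \<longleftrightarrow> (\<exists>c. finite {e. c e \<noteq> 0} \<and>
      (\<forall>v. f v = (\<Sum>e\<in>{e. c e \<noteq> 0}. c e * mono e v)))"

text \<open>Homogeneous polynomial of degree m (the zero polynomial is homogeneous of every degree).\<close>
definition homog :: "nat \<Rightarrow> (pt \<Rightarrow> complex) \<Rightarrow> bool" where
  "homog m f \<longleftrightarrow> (\<exists>c. finite {e. c e \<noteq> 0} \<and> (\<forall>e. c e \<noteq> 0 \<longrightarrow> mdeg e = m) \<and>
      (\<forall>v. f v = (\<Sum>e\<in>{e. c e \<noteq> 0}. c e * mono e v)))"

definition dX :: "(pt \<Rightarrow> complex) \<Rightarrow> pt \<Rightarrow> complex" where
  "dX f v = deriv (\<lambda>t. f (t, py v, pz v)) (px v)"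
definition dY :: "(pt \<Rightarrow> complex) \<Rightarrow> pt \<Rightarrow> complex" where
  "dY f v = deriv (\<lambda>t. f (px v, t, pz v)) (py v)"
definition dZ :: "(pt \<Rightarrow> complex) \<Rightarrow> pt \<Rightarrow> complex" where
  "dZ f v = deriv (\<lambda>t. f (px v, py v, t)) (pz v)"

definition smooth_cubic :: "(pt \<Rightarrow> complex) \<Rightarrow> bool" where
  "smooth_cubic g \<longleftrightarrow> homog 3 g \<and> g \<noteq> (\<lambda>_. 0) \<and>
     (\<forall>v. v \<noteq> 0 \<longrightarrow> \<not> (g v = 0 \<and> dX g v = 0 \<and> dY g v = 0 \<and> dZ g v = 0))"

definition is_line :: "(pt \<Rightarrow> complex) \<Rightarrow> bool" where
  "is_line g \<longleftrightarrow> homog 1 g \<and> g \<noteq> (\<lambda>_. 0)"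

text \<open>Zero set (cone over the projective curve).\<close>
definition zeros :: "(pt \<Rightarrow> complex) \<Rightarrow> pt set" where
  "zeros g = {v. g v = 0}"

type_synonym syz = "(pt \<Rightarrow> complex) \<times> (pt \<Rightarrow> complex) \<times> (pt \<Rightarrow> complex)"

definition Syz :: "(pt \<Rightarrow> complex) \<Rightarrow> syz set" where
  "Syz f = {(a,b,c). poly3 a \<and> poly3 b \<and> poly3 c \<and>
      (\<forall>v. a v * dX f v + b v * dY f v + c v * dZ f v = 0)}"

definition homog_syz :: "nat \<Rightarrow> syz \<Rightarrow> bool" where
  "homog_syz d r \<longleftrightarrow> homog d (fst r) \<and> homog d (fst (snd r)) \<and> homog d (snd (snd r))"

definition lincomb :: "(pt \<Rightarrow> complex) \<Rightarrow> syz \<Rightarrow> (pt \<Rightarrow> complex) \<Rightarrow> syz \<Rightarrow> syz" where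
  "lincomb p r1 q r2 = ((\<lambda>v. p v * fst r1 v + q v * fst r2 v),
                        (\<lambda>v. p v * fst (snd r1) v + q v * fst (snd r2) v),
                        (\<lambda>v. p v * snd (snd r1) v + q v * snd (snd r2) v))"

definition smult_syz :: "(pt \<Rightarrow> complex) \<Rightarrow> syz \<Rightarrow> syz" where
  "smult_syz p r = ((\<lambda>v. p v * fst r v), (\<lambda>v. p v * fst (snd r) v), (\<lambda>v. p v * snd (snd r) v))"

definition free_curve :: "nat \<Rightarrow> (pt \<Rightarrow> complex) \<Rightarrow> bool" where
  "free_curve m f \<longleftrightarrow> (\<exists>d1 d2 r1 r2.
      1 \<le> d1 \<and> d1 \<le> d2 \<and> d1 + d2 = m - 1 \<and>
      r1 \<in> Syz f \<and> r2 \<in> Syz f \<and> homog_syz d1 r1 \<and> homog_syz d2 r2 \<and>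
      (\<forall>s\<in>Syz f. \<exists>p q. poly3 p \<and> poly3 q \<and> s = lincomb p r1 q r2) \<and>
      \<not> (\<exists>p. poly3 p \<and> r1 = smult_syz p r2) \<and>
      \<not> (\<exists>p. poly3 p \<and> r2 = smult_syz p r1))"

definition holo2 :: "(complex \<times> complex \<Rightarrow> complex) \<Rightarrow> (complex \<times> complex) set \<Rightarrow> bool" where
  "holo2 F U \<longleftrightarrow> open U \<and> (\<forall>z\<in>U. \<exists>D. (F has_derivative D) (at z) \<and>
      (\<forall>c a b. D (c * a, c * b) = c * D (a, b)))"

definition contact_equiv :: "(complex \<times> complex \<Rightarrow> complex) \<Rightarrow> (complex \<times> complex \<Rightarrow> complex) \<Rightarrow> bool" where
  "contact_equiv h g \<longleftrightarrow> (\<exists>U V \<phi> \<psi> u.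
      open U \<and> open V \<and> (0,0) \<in> V \<and> \<phi> (0,0) = (0,0) \<and>
      \<phi> ` V = U \<and> \<psi> ` U = V \<and> (\<forall>z\<in>V. \<psi> (\<phi> z) = z) \<and> (\<forall>w\<in>U. \<phi> (\<psi> w) = w) \<and>
      holo2 (fst \<circ> \<phi>) V \<and> holo2 (snd \<circ> \<phi>) V \<and> holo2 (fst \<circ> \<psi>) U \<and> holo2 (snd \<circ> \<psi>) U \<and>
      holo2 u V \<and> (\<forall>z\<in>V. u z \<noteq> 0) \<and> (\<forall>z\<in>V. h (\<phi> z) = u z * g z))"

definition det3 :: "pt \<Rightarrow> pt \<Rightarrow> pt \<Rightarrow> complex" where
  "det3 p v w = px p * (py v * pz w - pz v * py w) - py p * (px v * pz w - pz v * px w)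
              + pz p * (px v * py w - py v * px w)"

definition chart :: "pt \<Rightarrow> pt \<Rightarrow> pt \<Rightarrow> complex \<times> complex \<Rightarrow> pt" where
  "chart p v w st = (px p + fst st * px v + snd st * px w,
                     py p + fst st * py v + snd st * py w,
                     pz p + fst st * pz v + snd st * pz w)"

definition sing_type :: "(pt \<Rightarrow> complex) \<Rightarrow> pt \<Rightarrow> (complex \<times> complex \<Rightarrow> complex) \<Rightarrow> bool" where
  "sing_type f p g \<longleftrightarrow> (\<exists>v w. det3 p v w \<noteq> 0 \<and> contact_equiv (\<lambda>st. f (chart p v w st)) g)"

definition nf_A1 :: "complex \<times> complex \<Rightarrow> complex" where "nf_A1 z = fst z ^ 2 + snd z ^ 2"
definition nf_A5 :: "complex \<times> complex \<Rightarrow> complex" where "nf_A5 z = fst z ^ 2 + snd z ^ 6"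
definition nf_D4 :: "complex \<times> complex \<Rightarrow> complex" where "nf_D4 z = fst z ^ 2 * snd z + snd z ^ 3"

definition sing_point :: "(pt \<Rightarrow> complex) \<Rightarrow> pt \<Rightarrow> bool" where
  "sing_point f p \<longleftrightarrow> p \<noteq> 0 \<and> f p = 0 \<and> dX f p = 0 \<and> dY f p = 0 \<and> dZ f p = 0"

end

theory Submission
  imports Defs "HOL-Complex_Analysis.Cauchy_Integral_Formula"
begin

text \<open>
  Freeness enters only through a nonzero syzygy \<open>\<delta> = (a, b, c)\<close> of degree \<open>r \<le> (m - 1) / 2\<close>, where
  \<open>m = 3k + d\<close>. If \<open>m \<ge> 10\<close>, then \<open>s = (r + 2) / m < 2 / 3\<close>, and \<open>2 / 3\<close> is the smallest log canonical
  threshold among \<open>A\<^sub>1\<close>, \<open>A\<^sub>5\<close> and \<open>D\<^sub>4\<close>; hence the weight \<open>|f|\<^bsup>-2s\<^esup>\<close> is locally integrable on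
  \<open>\<complex>\<^sup>3 - {0}\<close>. Regarded as a vector field, \<open>\<delta>\<close> kills \<open>f\<close>, so integration by parts against this weight
  produces no derivative of the weight. The exponent \<open>s\<close> is chosen such that, with radial cutoffs, the
  boundary contributions cancel by scale invariance. The first integration by parts gives
  \<open>\<integral> |div \<delta>|\<^sup>2 |f|\<^bsup>-2s\<^esup> = 0\<close>. With \<open>div \<delta> = 0\<close>, a second one, applied to \<open>x \<delta>\<close>, \<open>y \<delta>\<close> and \<open>z \<delta>\<close>, gives
  equality in the Cauchy-Schwarz inequality between \<open>\<delta>(v)\<close> and \<open>v\<close>. Thus \<open>\<delta>(v)\<close> is parallel to \<open>v\<close>, and
  Euler's formula together with \<open>\<delta> f = 0\<close> forces \<open>\<delta> = 0\<close>.
\<close>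

subsection \<open>Lipschitz images and Lebesgue measure\<close>

lemma Vitali_balls_in_open:
  fixes S :: "'a::euclidean_space set"
  assumes T: "open T" "S \<subseteq> T"
  obtains C and r :: "'a \<Rightarrow> real" where
    "countable C" "C \<subseteq> S" "\<forall>x\<in>C. 0 < r x \<and> ball x (r x) \<subseteq> T"
    "pairwise (\<lambda>x y. disjnt (ball x (r x)) (ball y (r y))) C" "S \<subseteq> (\<Union>x\<in>C. ball x (5 * r x))"
proof -
  have "\<exists>e. 0 < e \<and> e \<le> 1 \<and> ball x e \<subseteq> T" if x: "x \<in> S" for x
  proof -
    obtain e where "0 < e" "ball x e \<subseteq> T" using openE[OF T(1), of x] T(2) x by blast
    then show ?thesis by (intro exI[of _ "min e 1"]) auto
  qed
  then obtain r where r: "\<And>x. x \<in> S \<Longrightarrow> 0 < r x \<and> r x \<le> 1" "\<And>x. x \<in> S \<Longrightarrow> ball x (r x) \<subseteq> T"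
    by metis
  have cover: "S \<subseteq> (\<Union>x\<in>S. ball x (r x))" using r(1) by auto
  obtain C where C: "countable C" "C \<subseteq> S"
    "pairwise (\<lambda>x y. disjnt (ball x (r x)) (ball y (r y))) C" "S \<subseteq> (\<Union>x\<in>C. ball x (5 * r x))"
    by (rule Vitali_covering_lemma_balls[OF cover, of 1]) (use r(1) in blast)+
  show ?thesis by (rule that[OF C(1,2) _ C(3,4)]) (use r C(2) in blast)
qed

lemma Vitali_ball_sequence:
  fixes S :: "'a::euclidean_space set"
  assumes T: "open T" "S \<subseteq> T"
  obtains \<rho> :: "nat \<Rightarrow> real" and a :: "nat \<Rightarrow> 'a" where
    "\<forall>n. 0 \<le> \<rho> n" "\<forall>n. 0 < \<rho> n \<longrightarrow> a n \<in> S" "\<forall>n. ball (a n) (\<rho> n) \<subseteq> T"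
    "disjoint_family (\<lambda>n. ball (a n) (\<rho> n))" "\<forall>x\<in>S. \<exists>n. dist (a n) x < 5 * \<rho> n"
proof -
  obtain C and r :: "'a \<Rightarrow> real" where
    C: "countable C" "C \<subseteq> S" and r: "\<forall>x\<in>C. 0 < r x \<and> ball x (r x) \<subseteq> T"
    and disj: "pairwise (\<lambda>x y. disjnt (ball x (r x)) (ball y (r y))) C"
    and cover: "S \<subseteq> (\<Union>x\<in>C. ball x (5 * r x))"
    by (rule Vitali_balls_in_open[OF T])
  define N where "N = to_nat_on C ` C"
  define a where "a = from_nat_into C"
  define \<rho> where "\<rho> n = (if n \<in> N then r (a n) else 0)" for n
  have a: "a n \<in> C" if "n \<in> N" for n
    using that C(1) by (auto simp: N_def a_def)
  show ?thesis
  proof (rule that)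
    have "0 \<le> \<rho> n \<and> (0 < \<rho> n \<longrightarrow> a n \<in> S) \<and> ball (a n) (\<rho> n) \<subseteq> T" for n
      using a[of n] C(2) bspec[OF r, of "a n"] by (auto simp: \<rho>_def)
    then show "\<forall>n. 0 \<le> \<rho> n" "\<forall>n. 0 < \<rho> n \<longrightarrow> a n \<in> S" "\<forall>n. ball (a n) (\<rho> n) \<subseteq> T"
      by blast+
    show "\<forall>x\<in>S. \<exists>n. dist (a n) x < 5 * \<rho> n"
    proof
      fix x assume "x \<in> S"
      then have "x \<in> (\<Union>y\<in>C. ball y (5 * r y))" using cover by blast
      then obtain y where y: "y \<in> C" "dist y x < 5 * r y" by auto
      then have "to_nat_on C y \<in> N" "a (to_nat_on C y) = y" using C(1) by (auto simp: N_def a_def)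
      then show "\<exists>n. dist (a n) x < 5 * \<rho> n"
        using y(2) by (intro exI[of _ "to_nat_on C y"]) (simp add: \<rho>_def)
    qed
    show "disjoint_family (\<lambda>n. ball (a n) (\<rho> n))"
      unfolding disjoint_family_on_def
    proof (intro ballI impI)
      fix i j :: nat assume "i \<noteq> j"
      then have "a i \<noteq> a j" if "i \<in> N" "j \<in> N" using that C(1) by (auto simp: N_def a_def)
      then show "ball (a i) (\<rho> i) \<inter> ball (a j) (\<rho> j) = {}"
        using a disj by (auto simp: pairwise_def disjnt_def \<rho>_def)
    qed
  qed
qed

lemma emeasure_lipschitz_image_le_open:
  fixes \<Phi> :: "'a::euclidean_space \<Rightarrow> 'a"
  assumes lip: "L-lipschitz_on S \<Phi>" and T: "open T" "S \<subseteq> T"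
  shows "emeasure lborel (\<Phi> ` S) \<le> ennreal ((5 * L) ^ DIM('a)) * emeasure lborel T"
proof -
  have L: "0 \<le> L" using lip by (rule lipschitz_on_nonneg)
  obtain \<rho> and a :: "nat \<Rightarrow> 'a" where
    \<rho>: "\<forall>n. 0 \<le> \<rho> n" "\<forall>n. 0 < \<rho> n \<longrightarrow> a n \<in> S" "\<forall>n. ball (a n) (\<rho> n) \<subseteq> T"
      "disjoint_family (\<lambda>n. ball (a n) (\<rho> n))" "\<forall>x\<in>S. \<exists>n. dist (a n) x < 5 * \<rho> n"
    by (rule Vitali_ball_sequence[OF T])
  have "\<Phi> ` S \<subseteq> (\<Union>n. cball (\<Phi> (a n)) (L * (5 * \<rho> n)))"
  proof (rule image_subsetI)
    fix x assume x: "x \<in> S"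
    then obtain n where n: "dist (a n) x < 5 * \<rho> n" using \<rho>(5) by blast
    then have "a n \<in> S" using \<rho>(2) zero_le_dist[of "a n" x] by (auto simp del: zero_le_dist)
    then have "dist (\<Phi> (a n)) (\<Phi> x) \<le> L * dist (a n) x" by (rule lipschitz_onD[OF lip _ x])
    also have "\<dots> \<le> L * (5 * \<rho> n)" using n L by (intro mult_left_mono) auto
    finally show "\<Phi> x \<in> (\<Union>n. cball (\<Phi> (a n)) (L * (5 * \<rho> n)))" by auto
  qed
  then have "emeasure lborel (\<Phi> ` S) \<le> emeasure lborel (\<Union>n. cball (\<Phi> (a n)) (L * (5 * \<rho> n)))"
    by (rule emeasure_mono) auto
  also have "\<dots> \<le> (\<Sum>n. emeasure lborel (cball (\<Phi> (a n)) (L * (5 * \<rho> n))))"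
    by (rule emeasure_subadditive_countably) auto
  also have "\<dots> = (\<Sum>n. ennreal ((5 * L) ^ DIM('a)) * emeasure lborel (ball (a n) (\<rho> n)))"
  proof (rule suminf_cong)
    fix n
    have "unit_ball_vol DIM('a) * (L * (5 * \<rho> n)) ^ DIM('a)
        = (5 * L) ^ DIM('a) * (unit_ball_vol DIM('a) * \<rho> n ^ DIM('a))"
      by (simp add: power_mult_distrib)
    then show "emeasure lborel (cball (\<Phi> (a n)) (L * (5 * \<rho> n)))
        = ennreal ((5 * L) ^ DIM('a)) * emeasure lborel (ball (a n) (\<rho> n))"
      using L \<rho>(1) by (simp add: emeasure_cball emeasure_ball ennreal_mult[symmetric])
  qed
  also have "\<dots> = ennreal ((5 * L) ^ DIM('a)) * emeasure lborel (\<Union>n. ball (a n) (\<rho> n))"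
    using \<rho>(4) by (subst suminf_emeasure[symmetric]) auto
  also have "\<dots> \<le> ennreal ((5 * L) ^ DIM('a)) * emeasure lborel T"
    using T(1) \<rho>(3) by (intro mult_left_mono emeasure_mono UN_least) auto
  finally show ?thesis .
qed

lemma emeasure_lipschitz_image_le:
  fixes \<Phi> :: "'a::euclidean_space \<Rightarrow> 'a"
  assumes lip: "L-lipschitz_on S \<Phi>" and S: "S \<in> sets borel"
  shows "emeasure lborel (\<Phi> ` S) \<le> ennreal ((5 * L) ^ DIM('a)) * emeasure lborel S"
proof (rule ennreal_le_epsilon)
  define C where "C = (5 * L) ^ DIM('a)"
  have C: "0 \<le> C" using lipschitz_on_nonneg[OF lip] by (simp add: C_def)
  fix \<epsilon> :: real assume \<epsilon>: "0 < \<epsilon>"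
  define \<eta> where "\<eta> = \<epsilon> / (C + 1)"
  have \<eta>: "0 < \<eta>" "C * \<eta> \<le> \<epsilon>" using \<epsilon> C by (auto simp: \<eta>_def field_simps)
  obtain T where T: "open T" "S \<subseteq> T" "emeasure lborel (T - S) < ennreal \<eta>"
    using outer_regular_lborel[OF S \<eta>(1)] by auto
  have "emeasure lborel (\<Phi> ` S) \<le> ennreal C * emeasure lborel T"
    unfolding C_def by (rule emeasure_lipschitz_image_le_open[OF lip T(1,2)])
  also have "emeasure lborel T = emeasure lborel S + emeasure lborel (T - S)"
    using T S by (subst plus_emeasure) (auto simp: Un_absorb1)
  also have "ennreal C * \<dots> \<le> ennreal C * (emeasure lborel S + ennreal \<eta>)"
    using T(3) by (intro mult_left_mono add_left_mono) auto
  also have "\<dots> = ennreal C * emeasure lborel S + ennreal (C * \<eta>)"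
    using \<eta>(1) C by (simp add: distrib_left ennreal_mult)
  also have "\<dots> \<le> ennreal C * emeasure lborel S + ennreal \<epsilon>"
    using \<eta>(2) by (intro add_left_mono ennreal_leI)
  finally show "emeasure lborel (\<Phi> ` S)
      \<le> ennreal ((5 * L) ^ DIM('a)) * emeasure lborel S + ennreal \<epsilon>"
    unfolding C_def .
qed

lemma density_lipschitz_image_le:
  fixes \<Phi> :: "'a::euclidean_space \<Rightarrow> 'a"
  assumes lip: "L-lipschitz_on V \<Phi>" and [measurable]: "V \<in> sets borel" "\<Phi> ` V \<in> sets borel"
    and \<Phi>: "\<Phi> \<in> borel_measurable (restrict_space lborel V)"
  shows "density lborel (indicator (\<Phi> ` V))
    \<le> scale_measure (ennreal ((5 * L) ^ DIM('a))) (distr (restrict_space lborel V) borel \<Phi>)"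
    (is "?M \<le> scale_measure ?C ?D")
proof (subst le_measure, simp, intro ballI)
  fix A assume "A \<in> sets ?M"
  then have A [measurable]: "A \<in> sets borel" by simp
  define S where "S = \<Phi> -` A \<inter> V"
  have "S \<in> sets (restrict_space lborel V)"
    using measurable_sets[OF \<Phi>, of A] by (simp add: S_def space_restrict_space)
  then have S: "S \<in> sets borel" by (auto simp: sets_restrict_space)
  have "emeasure ?M A = emeasure lborel (\<Phi> ` V \<inter> A)"
    by (subst emeasure_density) (auto simp: indicator_inter_arith[symmetric])
  also have "\<Phi> ` V \<inter> A = \<Phi> ` S" by (auto simp: S_def)
  also have "emeasure lborel (\<Phi> ` S) \<le> ?C * emeasure lborel S"
    by (rule emeasure_lipschitz_image_le[OF lipschitz_on_subset[OF lip] S]) (auto simp: S_def)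
  also have "emeasure lborel S = emeasure ?D A"
    using \<Phi>
    by (subst emeasure_distr) (auto simp: emeasure_restrict_space space_restrict_space S_def)
  finally show "emeasure ?M A \<le> emeasure (scale_measure ?C ?D) A" by simp
qed

lemma nn_integral_lipschitz_image_le:
  fixes \<Phi> :: "'a::euclidean_space \<Rightarrow> 'a" and q :: "'a \<Rightarrow> ennreal"
  assumes lip: "L-lipschitz_on V \<Phi>" and V [measurable]: "V \<in> sets borel" "\<Phi> ` V \<in> sets borel"
    and [measurable]: "q \<in> borel_measurable borel"
  shows "(\<integral>\<^sup>+y\<in>\<Phi> ` V. q y \<partial>lborel) \<le> ennreal ((5 * L) ^ DIM('a)) * (\<integral>\<^sup>+x\<in>V. q (\<Phi> x) \<partial>lborel)"
proof -
  let ?D = "distr (restrict_space lborel V) borel \<Phi>"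
  have "\<Phi> \<in> borel_measurable (restrict_space borel V)"
    by (rule borel_measurable_continuous_on_restrict[OF lipschitz_on_continuous_on[OF lip]])
  moreover have "sets (restrict_space borel V) = sets (restrict_space lborel V)"
    by (simp add: sets_restrict_space)
  ultimately have \<Phi> [measurable]: "\<Phi> \<in> borel_measurable (restrict_space lborel V)"
    using measurable_cong_sets by blast
  have "(\<integral>\<^sup>+y\<in>\<Phi> ` V. q y \<partial>lborel) = nn_integral (density lborel (indicator (\<Phi> ` V))) q"
    by (subst nn_integral_density) (auto simp: mult.commute)
  also have "\<dots> \<le> nn_integral (scale_measure (ennreal ((5 * L) ^ DIM('a))) ?D) q"
    by (intro nn_integral_mono_measure density_lipschitz_image_le lip V \<Phi>) auto
  also have "\<dots> = ennreal ((5 * L) ^ DIM('a)) * nn_integral ?D q"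
    by (rule nn_integral_scale_measure) simp
  also have "nn_integral ?D q = (\<integral>\<^sup>+x\<in>V. q (\<Phi> x) \<partial>lborel)"
    by (subst nn_integral_distr) (auto simp: nn_integral_restrict_space)
  finally show ?thesis .
qed

subsection \<open>Negative powers of the norm\<close>

lemma sets_borel_balls [measurable]: "ball a r \<in> sets borel" "cball a r \<in> sets borel"
  by simp_all

lemma norm_powr_le_dyadic_sum:
  fixes q R :: real
  assumes q: "0 \<le> q" and x: "x \<in> cball 0 R"
  shows "ennreal (norm x powr (- q))
    \<le> (\<Sum>n. ennreal ((R / 2 ^ Suc n) powr (- q)) * indicator (cball 0 (R / 2 ^ n)) x)"
proof (cases "x = 0")
  case False
  then have R: "0 < R" using x less_le_trans[of 0 "norm x" R] by simp
  define n where "n = (LEAST n. R / 2 ^ Suc n < norm x)"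
  obtain k where "(1 / 2) ^ k < norm x / R"
    using real_arch_pow_inv[of "norm x / R" "1 / 2"] R False by auto
  then have "R / 2 ^ Suc k < norm x"
    using R False by (simp add: field_simps power_divide)
  then have n: "R / 2 ^ Suc n < norm x" unfolding n_def by (rule LeastI)
  have "x \<in> cball 0 (R / 2 ^ n)"
  proof (cases n)
    case (Suc k)
    then have "\<not> R / 2 ^ Suc k < norm x"
      using not_less_Least[of k "\<lambda>n. R / 2 ^ Suc n < norm x"] by (simp add: n_def)
    then show ?thesis using Suc by simp
  qed (use x in simp)
  moreover have "norm x powr (- q) \<le> (R / 2 ^ Suc n) powr (- q)"
    using n q R by (intro powr_mono2') auto
  ultimately have "ennreal (norm x powr (- q))
      \<le> ennreal ((R / 2 ^ Suc n) powr (- q)) * indicator (cball 0 (R / 2 ^ n)) x"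
    by (simp add: ennreal_leI)
  also have "\<dots>
      = sum (\<lambda>n. ennreal ((R / 2 ^ Suc n) powr (- q)) * indicator (cball 0 (R / 2 ^ n)) x) {n}"
    by (simp only: sum.insert sum.empty finite.emptyI empty_iff not_False_eq_True add_0_right)
  also have "\<dots> \<le> (\<Sum>n. ennreal ((R / 2 ^ Suc n) powr (- q)) * indicator (cball 0 (R / 2 ^ n)) x)"
    by (rule sum_le_suminf) auto
  finally show ?thesis .
qed simp

lemma dyadic_powr_mult_power:
  fixes q R :: real
  assumes "0 < R"
  shows "(R / 2 ^ Suc n) powr (- q) * (R / 2 ^ n) ^ D
    = (R / 2) powr (- q) * R ^ D * (2 powr q / 2 ^ D) ^ n"
proof -
  have "R / 2 ^ Suc n = R / 2 * 2 powr (- real n)"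
    by (simp add: powr_minus powr_realpow field_simps)
  then have "(R / 2 ^ Suc n) powr (- q) = (R / 2) powr (- q) * (2 powr (- real n)) powr (- q)"
    using assms by (simp only: powr_mult)
  also have "(2 powr (- real n)) powr (- q) = (2 powr q) ^ n"
    by (simp add: powr_powr powr_power mult.commute)
  finally show ?thesis
    by (simp add: power_divide power_mult_distrib mult_ac flip: power_mult)
qed

lemma nn_integral_norm_powr_cball_finite:
  fixes q R :: real
  assumes q: "0 \<le> q" "q < DIM('a)"
  shows "(\<integral>\<^sup>+x\<in>cball (0::'a::euclidean_space) R. ennreal (norm x powr (- q)) \<partial>lborel) < \<infinity>"
proof (cases "0 < R")
  case False
  then have "ennreal (norm x powr (- q)) * indicator (cball 0 R) x = 0" for x :: 'a
    using less_le_trans[of 0 "norm x" R] by (cases "x = 0") (auto simp: indicator_def)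
  then have "(\<integral>\<^sup>+x\<in>cball (0::'a) R. ennreal (norm x powr (- q)) \<partial>lborel) = 0"
    by (simp only: nn_integral_const) simp
  then show ?thesis by simp
next
  case R: True
  define D where "D = DIM('a)"
  define K where "K = unit_ball_vol (real D) * ((R / 2) powr (- q) * R ^ D)"
  define x where "x = 2 powr q / 2 ^ D"
  have x: "0 \<le> x" "x < 1"
    using powr_less_mono[of q "real D" 2] q(2) by (auto simp: x_def D_def powr_realpow)
  have "(\<integral>\<^sup>+y\<in>cball (0::'a) R. ennreal (norm y powr (- q)) \<partial>lborel)
      \<le> (\<integral>\<^sup>+y. (\<Sum>n. ennreal ((R / 2 ^ Suc n) powr (- q))
          * indicator (cball (0::'a) (R / 2 ^ n)) y) \<partial>lborel)"
  proof (rule nn_integral_mono)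
    fix y :: 'a
    show "ennreal (norm y powr (- q)) * indicator (cball 0 R) y
        \<le> (\<Sum>n. ennreal ((R / 2 ^ Suc n) powr (- q)) * indicator (cball 0 (R / 2 ^ n)) y)"
      using norm_powr_le_dyadic_sum[OF q(1), of y R]
      by (cases "y \<in> cball 0 R") (simp_all del: mem_cball_0)
  qed
  also have "\<dots>
      = (\<Sum>n. ennreal ((R / 2 ^ Suc n) powr (- q)) * emeasure lborel (cball (0::'a) (R / 2 ^ n)))"
    by (subst nn_integral_suminf) (simp_all add: nn_integral_cmult_indicator)
  also have "\<dots> = (\<Sum>n. ennreal (K * x ^ n))"
  proof (rule suminf_cong)
    fix n
    have "K * x ^ n = (R / 2 ^ Suc n) powr (- q) * (unit_ball_vol (real D) * (R / 2 ^ n) ^ D)"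
      using dyadic_powr_mult_power[OF R, of n q D] by (simp add: K_def x_def)
    then show "ennreal ((R / 2 ^ Suc n) powr (- q)) * emeasure lborel (cball (0::'a) (R / 2 ^ n))
        = ennreal (K * x ^ n)"
      using R unfolding D_def by (subst emeasure_cball) (simp_all add: ennreal_mult)
  qed
  also have "\<dots> = ennreal (\<Sum>n. K * x ^ n)"
    by (rule suminf_ennreal2)
       (use x R in \<open>auto simp: K_def intro!: summable_mult summable_geometric\<close>)
  also have "\<dots> < \<infinity>" by simp
  finally show ?thesis .
qed

subsection \<open>The weight\<close>

text \<open>The weight is infinite at \<open>0\<close>, so that a finite integral of \<open>weight q \<circ> f\<close> also shows that the
  zero set of \<open>f\<close> is a null set.\<close>

definition weight :: "real \<Rightarrow> complex \<Rightarrow> ennreal" where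
  "weight q t = (if t = 0 then \<infinity> else ennreal (norm t powr (- q)))"

lemma borel_measurable_weight [measurable]: "weight q \<in> borel_measurable borel"
  unfolding weight_def by measurable

lemma weight_less_top: "t \<noteq> 0 \<Longrightarrow> weight q t < \<infinity>"
  by (simp add: weight_def)

lemma weight_mult: "weight q (a * b) = weight q a * weight q b"
  by (auto simp: weight_def norm_mult powr_mult ennreal_mult ennreal_top_mult ennreal_mult_top)

lemma weight_add_exponent: "weight (q + q') t = weight q t * weight q' t"
  by (auto simp: weight_def powr_add[symmetric] ennreal_mult[symmetric] ennreal_top_mult)

lemma weight_antimono: "q \<ge> 0 \<Longrightarrow> norm a \<le> norm b \<Longrightarrow> weight q b \<le> weight q a"
  by (auto simp: weight_def intro!: ennreal_leI powr_mono2')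

lemma weight_mono_exponent: "q \<le> q' \<Longrightarrow> norm t \<le> 1 \<Longrightarrow> weight q t \<le> weight q' t"
  by (auto simp: weight_def intro!: ennreal_leI powr_mono')

lemma weight_cube: "weight q (t ^ 3) = weight (3 * q) t"
  using weight_add_exponent[of "q + q" q t] weight_add_exponent[of q q t]
  by (simp add: power3_eq_cube weight_mult)

lemma nn_integral_weight_cball_finite:
  assumes "0 \<le> q" "q < 2"
  shows "(\<integral>\<^sup>+t\<in>cball 0 R. weight q t \<partial>lborel) < \<infinity>"
proof -
  have "AE t in lborel. weight q t * indicator (cball 0 R) t
      = ennreal (norm t powr (- q)) * indicator (cball 0 R) t"
    by (rule AE_mp[OF AE_lborel_singleton[of 0]]) (simp add: weight_def)
  then have "(\<integral>\<^sup>+t\<in>cball 0 R. weight q t \<partial>lborel)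
      = (\<integral>\<^sup>+t\<in>cball (0::complex) R. ennreal (norm t powr (- q)) \<partial>lborel)"
    by (rule nn_integral_cong_AE)
  then show ?thesis using nn_integral_norm_powr_cball_finite[where 'a = complex] assms by simp
qed

lemma nn_integral_weight_translate_le:
  fixes c :: complex
  shows "(\<integral>\<^sup>+t\<in>cball 0 R. weight q (t + c) \<partial>lborel) \<le> (\<integral>\<^sup>+t\<in>cball 0 (R + norm c). weight q t \<partial>lborel)"
proof -
  have "(\<integral>\<^sup>+t\<in>cball 0 R. weight q (t + c) \<partial>lborel)
      \<le> (\<integral>\<^sup>+t. weight q (c + t) * indicator (cball 0 (R + norm c)) (c + t) \<partial>lborel)"
    by (rule nn_integral_mono)
       (auto simp: indicator_def add.commute intro: order_trans[OF norm_triangle_ineq])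
  also have "\<dots> = (\<integral>\<^sup>+t\<in>cball 0 (R + norm c). weight q t \<partial>distr lborel borel ((+) c))"
    by (subst nn_integral_distr) auto
  finally show ?thesis by (simp add: lborel_distr_plus)
qed

text \<open>Comparing with a point \<open>s\<^sub>0\<close> of the disc where \<open>|h|\<close> is minimal gives \<open>|h s| \<ge> c/2 |s - s\<^sub>0|\<close>.\<close>

lemma nn_integral_weight_expanding_le:
  fixes h :: "complex \<Rightarrow> complex"
  assumes q: "q \<ge> 0" and c: "c > 0" and h: "continuous_on (cball 0 r) h"
    and expanding: "\<And>s s'. s \<in> cball 0 r \<Longrightarrow> s' \<in> cball 0 r \<Longrightarrow> c * norm (s - s') \<le> norm (h s - h s')"
  shows "(\<integral>\<^sup>+s\<in>cball 0 r. weight q (h s) \<partial>lborel)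
    \<le> weight q (of_real (c / 2)) * (\<integral>\<^sup>+s\<in>cball 0 (2 * r). weight q s \<partial>lborel)"
proof (cases "0 \<le> r")
  case True
  obtain s0 where s0: "s0 \<in> cball 0 r" "\<And>s. s \<in> cball 0 r \<Longrightarrow> norm (h s0) \<le> norm (h s)"
    using continuous_attains_inf[of "cball 0 r" "\<lambda>s. norm (h s)"] continuous_on_norm[OF h] True
    by (metis cball_eq_empty compact_cball not_less)
  have "(\<integral>\<^sup>+s\<in>cball 0 r. weight q (h s) \<partial>lborel)
      \<le> (\<integral>\<^sup>+s. weight q (of_real (c / 2)) * (weight q (s + - s0) * indicator (cball 0 r) s) \<partial>lborel)"
  proof (rule nn_integral_mono)
    fix s :: complex
    show "weight q (h s) * indicator (cball 0 r) s
        \<le> weight q (of_real (c / 2)) * (weight q (s + - s0) * indicator (cball 0 r) s)"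
    proof (cases "s \<in> cball 0 r")
      case True
      have "c * norm (s - s0) \<le> norm (h s) + norm (h s0)"
        using expanding[OF True s0(1)] norm_triangle_ineq4[of "h s" "h s0"] by linarith
      also have "\<dots> \<le> 2 * norm (h s)" using s0(2)[OF True] by simp
      finally have "norm (of_real (c / 2) * (s + - s0)) \<le> norm (h s)"
        using c by (simp add: norm_mult)
      then have "weight q (h s) \<le> weight q (of_real (c / 2)) * weight q (s + - s0)"
        unfolding weight_mult[symmetric] by (rule weight_antimono[OF q])
      then show ?thesis using True by simp
    qed simp
  qed
  also have "\<dots> = weight q (of_real (c / 2)) * (\<integral>\<^sup>+s\<in>cball 0 r. weight q (s + - s0) \<partial>lborel)"
    by (rule nn_integral_cmult) simp
  also have "\<dots> \<le> weight q (of_real (c / 2)) * (\<integral>\<^sup>+s\<in>cball 0 (2 * r). weight q s \<partial>lborel)"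
    using s0(1)
    by (intro mult_left_mono order_trans[OF nn_integral_weight_translate_le] nn_integral_mono)
       (auto simp: indicator_def)
  finally show ?thesis .
qed (simp add: cball_empty)

definition weight_integrable_at :: "real \<Rightarrow> ('a::euclidean_space \<Rightarrow> complex) \<Rightarrow> 'a \<Rightarrow> bool" where
  "weight_integrable_at q F p \<longleftrightarrow> (\<exists>U. open U \<and> p \<in> U \<and> (\<integral>\<^sup>+x\<in>U. weight q (F x) \<partial>lborel) < \<infinity>)"

lemma weight_integrable_at_lipschitz_image:
  fixes \<Phi> :: "'a::euclidean_space \<Rightarrow> 'a"
  assumes q: "q \<ge> 0" and V: "open V" "x0 \<in> V" and \<Phi>: "L-lipschitz_on V \<Phi>" "inj_on \<Phi> V"
    and [measurable]: "F \<in> borel_measurable borel" "g \<in> borel_measurable borel"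
    and c: "c > 0" "\<And>x. x \<in> V \<Longrightarrow> c * norm (g x) \<le> norm (F (\<Phi> x))"
    and g: "weight_integrable_at q g x0"
  shows "weight_integrable_at q F (\<Phi> x0)"
proof -
  obtain U where U: "open U" "x0 \<in> U" "(\<integral>\<^sup>+x\<in>U. weight q (g x) \<partial>lborel) < \<infinity>"
    using g by (auto simp: weight_integrable_at_def)
  define N where "N = U \<inter> V"
  have lip: "L-lipschitz_on N \<Phi>" by (rule lipschitz_on_subset[OF \<Phi>(1)]) (simp add: N_def)
  have N: "open N" "x0 \<in> N" using U V by (auto simp: N_def)
  have "open (\<Phi> ` N)"
    by (rule invariance_of_domain[OF lipschitz_on_continuous_on[OF lip] N(1)])
       (rule inj_on_subset[OF \<Phi>(2)], simp add: N_def)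
  note [measurable] = borel_open[OF this] borel_open[OF N(1)] borel_open[OF U(1)]
  define K where "K = ennreal ((5 * L) ^ DIM('a))"
  have "(\<integral>\<^sup>+y\<in>\<Phi> ` N. weight q (F y) \<partial>lborel) \<le> K * (\<integral>\<^sup>+x\<in>N. weight q (F (\<Phi> x)) \<partial>lborel)"
    unfolding K_def by (rule nn_integral_lipschitz_image_le[OF lip]) measurable
  also have "\<dots> \<le> K * (\<integral>\<^sup>+x. weight q (of_real c) * (weight q (g x) * indicator U x) \<partial>lborel)"
  proof (intro mult_left_mono nn_integral_mono)
    fix x
    show "weight q (F (\<Phi> x)) * indicator N x
        \<le> weight q (of_real c) * (weight q (g x) * indicator U x)"
    proof (cases "x \<in> N")
      case True
      have "weight q (F (\<Phi> x)) \<le> weight q (of_real c * g x)"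
        using c True by (intro weight_antimono[OF q]) (simp add: norm_mult N_def)
      then show ?thesis using True by (simp add: weight_mult N_def)
    qed simp
  qed simp
  also have "\<dots> = K * (weight q (of_real c) * (\<integral>\<^sup>+x\<in>U. weight q (g x) \<partial>lborel))"
    by (subst nn_integral_cmult) auto
  also have "\<dots> < \<infinity>"
    using U(3) c(1) weight_less_top[of "of_real c" q] by (auto simp: K_def ennreal_mult_less_top)
  finally show ?thesis
    unfolding weight_integrable_at_def using \<open>open (\<Phi> ` N)\<close> N(2) by blast
qed

lemma weight_integrable_at_nonzero:
  assumes F: "continuous_on UNIV F" and p: "F p \<noteq> 0" and q: "q \<ge> 0"
  shows "weight_integrable_at q F p"
proof -
  define V where "V = {x. norm (F p) / 2 < norm (F x)}"
  have V: "open V" "p \<in> V"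
    unfolding V_def using p F by (auto intro!: open_Collect_less continuous_intros)
  have "emeasure lborel (ball p 1) < \<infinity>" using emeasure_lborel_ball_finite by simp
  then have const_1: "weight_integrable_at q (\<lambda>_. 1) p"
    unfolding weight_integrable_at_def by (intro exI[of _ "ball p 1"]) (simp add: weight_def)
  show ?thesis
    by (rule weight_integrable_at_lipschitz_image[OF q V lipschitz_on_id inj_on_id2 _ _ _ _ const_1,
          where c = "norm (F p) / 2"])
       (use F p in \<open>auto simp: V_def intro: borel_measurable_continuous_onI\<close>)
qed

lemma weight_integrable_at_snd:
  fixes F :: "'b::euclidean_space \<Rightarrow> complex" and a :: "'a::euclidean_space"
  assumes [measurable]: "F \<in> borel_measurable borel" and F: "weight_integrable_at q F b"
  shows "weight_integrable_at q (\<lambda>x. F (snd x)) (a, b)"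
proof -
  obtain U where U: "open U" "b \<in> U" "(\<integral>\<^sup>+x\<in>U. weight q (F x) \<partial>lborel) < \<infinity>"
    using F by (auto simp: weight_integrable_at_def)
  have [measurable]: "U \<in> sets borel" using U(1) by simp
  have "(\<integral>\<^sup>+x\<in>ball a 1 \<times> U. weight q (F (snd x)) \<partial>lborel)
      = (\<integral>\<^sup>+x. indicator (ball a 1) (fst x)
          * (weight q (F (snd x)) * indicator U (snd x)) \<partial>(lborel \<Otimes>\<^sub>M lborel))"
    unfolding lborel_prod
    by (intro nn_integral_cong) (auto simp: indicator_def)
  also have "\<dots>
      = (\<integral>\<^sup>+y. (\<integral>\<^sup>+x. indicator (ball a 1) x * (weight q (F y) * indicator U y) \<partial>lborel) \<partial>lborel)"
    by (subst lborel_pair.nn_integral_snd[symmetric]) auto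
  also have "\<dots> = emeasure lborel (ball a 1) * (\<integral>\<^sup>+y\<in>U. weight q (F y) \<partial>lborel)"
    by (subst nn_integral_multc) (auto simp: nn_integral_cmult)
  also have "\<dots> < \<infinity>"
    using U(3) emeasure_lborel_ball_finite[of a 1] by (auto simp: ennreal_mult_less_top)
  finally show ?thesis
    unfolding weight_integrable_at_def using U
    by (intro exI[of _ "ball a 1 \<times> U"]) (auto intro: open_Times)
qed

text \<open>By translation invariance, the integral of \<open>g\<close> near \<open>p\<close> is an average over \<open>s\<close> of integrals of
  \<open>g (x + e s)\<close>.\<close>

lemma nn_integral_average_translates_le:
  fixes g :: "'a::euclidean_space \<Rightarrow> ennreal" and e :: "'b::euclidean_space \<Rightarrow> 'a"
  assumes [measurable]: "g \<in> borel_measurable borel" "e \<in> borel_measurable borel" "S \<in> sets borel"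
    and small: "\<And>s. s \<in> S \<Longrightarrow> norm (e s) \<le> r"
  shows "emeasure lborel S * (\<integral>\<^sup>+x\<in>ball p r. g x \<partial>lborel)
    \<le> (\<integral>\<^sup>+x\<in>ball p (2 * r). (\<integral>\<^sup>+s\<in>S. g (x + e s) \<partial>lborel) \<partial>lborel)"
proof -
  have "(\<integral>\<^sup>+x. g (e s + x) * indicator (ball p r) (e s + x) \<partial>lborel) = (\<integral>\<^sup>+x\<in>ball p r. g x \<partial>lborel)"
    for s
    using nn_integral_distr[of "(+) (e s)" lborel borel "\<lambda>x. g x * indicator (ball p r) x"]
    by (simp add: lborel_distr_plus)
  then have "emeasure lborel S * (\<integral>\<^sup>+x\<in>ball p r. g x \<partial>lborel)
      = (\<integral>\<^sup>+s. (\<integral>\<^sup>+x. g (e s + x) * indicator (ball p r) (e s + x) \<partial>lborel) * indicator S s \<partial>lborel)"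
    by (simp add: nn_integral_cmult mult.commute[of _ "indicator S _"] nn_integral_multc)
  also have "\<dots>
      \<le> (\<integral>\<^sup>+s. (\<integral>\<^sup>+x. g (x + e s) * indicator S s * indicator (ball p (2 * r)) x \<partial>lborel) \<partial>lborel)"
  proof (rule nn_integral_mono)
    fix s :: 'b
    have "g (e s + x) * indicator (ball p r) (e s + x) \<le> g (x + e s) * indicator (ball p (2 * r)) x"
      if s: "s \<in> S" for x
    proof -
      have "x \<in> ball p (2 * r)" if "e s + x \<in> ball p r"
        using that small[OF s] norm_triangle_ineq[of "p - (e s + x)" "e s"] by (simp add: dist_norm)
      then show ?thesis by (auto simp: indicator_def add.commute)
    qed
    then show "(\<integral>\<^sup>+x. g (e s + x) * indicator (ball p r) (e s + x) \<partial>lborel) * indicator S s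
        \<le> (\<integral>\<^sup>+x. g (x + e s) * indicator S s * indicator (ball p (2 * r)) x \<partial>lborel)"
      by (cases "s \<in> S") (auto intro: nn_integral_mono)
  qed
  also have "\<dots> = (\<integral>\<^sup>+x\<in>ball p (2 * r). (\<integral>\<^sup>+s\<in>S. g (x + e s) \<partial>lborel) \<partial>lborel)"
    by (subst lborel_pair.Fubini') (auto simp: nn_integral_multc)
  finally show ?thesis .
qed

lemma bounded_linear_small_cball:
  fixes e :: "'a::real_normed_vector \<Rightarrow> 'b::real_normed_vector"
  assumes e: "bounded_linear e" and \<epsilon>: "0 < \<epsilon>" "0 < r"
  obtains \<rho> where "0 < \<rho>" "\<rho> \<le> r" "\<And>s. s \<in> cball 0 \<rho> \<Longrightarrow> norm (e s) \<le> \<epsilon>"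
proof -
  obtain K where K: "K > 0" "\<And>s. norm (e s) \<le> norm s * K"
    using bounded_linear.pos_bounded[OF e] by blast
  define \<rho> where "\<rho> = min r (\<epsilon> / K)"
  have \<rho>: "0 < \<rho>" "\<rho> \<le> r" "\<rho> * K \<le> \<epsilon>"
    using K(1) \<epsilon> by (auto simp: \<rho>_def min_def field_simps)
  have "norm (e s) \<le> \<epsilon>" if "s \<in> cball 0 \<rho>" for s
  proof -
    have "norm s * K \<le> \<rho> * K" using that K(1) by simp
    then show ?thesis using K(2)[of s] \<rho>(3) by linarith
  qed
  then show ?thesis using that \<rho>(1,2) by blast
qed

lemma weight_integrable_at_expanding_direction:
  fixes F :: "'a::euclidean_space \<Rightarrow> complex" and e :: "complex \<Rightarrow> 'a"
  assumes q: "0 \<le> q" "q < 2" and F: "continuous_on UNIV F" and e: "bounded_linear e"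
    and pos: "c > 0" "r > 0"
    and expanding: "\<And>x s s'. x \<in> ball p r \<Longrightarrow> s \<in> cball 0 r \<Longrightarrow> s' \<in> cball 0 r \<Longrightarrow>
      c * norm (s - s') \<le> norm (F (x + e s) - F (x + e s'))"
  shows "weight_integrable_at q F p"
proof -
  have [measurable]: "F \<in> borel_measurable borel" "e \<in> borel_measurable borel"
    using F linear_continuous_on[OF e] by (auto intro: borel_measurable_continuous_onI)
  obtain \<rho> where \<rho>: "0 < \<rho>" "\<rho> \<le> r" and small: "\<And>s. s \<in> cball 0 \<rho> \<Longrightarrow> norm (e s) \<le> r / 2"
    by (rule bounded_linear_small_cball[OF e, of "r / 2" r]) (use pos(2) in auto)
  define J where "J = weight q (of_real (c / 2)) * (\<integral>\<^sup>+s\<in>cball 0 (2 * \<rho>). weight q s \<partial>lborel)"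
  define I where "I = (\<integral>\<^sup>+x\<in>ball p (r / 2). weight q (F x) \<partial>lborel)"
  have line: "(\<integral>\<^sup>+s\<in>cball 0 \<rho>. weight q (F (x + e s)) \<partial>lborel) \<le> J" if x: "x \<in> ball p r" for x
    unfolding J_def
  proof (rule nn_integral_weight_expanding_le[OF q(1) pos(1)])
    show "continuous_on (cball 0 \<rho>) (\<lambda>s. F (x + e s))"
      by (intro continuous_on_compose2[OF F] continuous_intros linear_continuous_on e) auto
    show "c * norm (s - s') \<le> norm (F (x + e s) - F (x + e s'))"
      if "s \<in> cball 0 \<rho>" "s' \<in> cball 0 \<rho>" for s s'
      using expanding[OF x, of s s'] that \<rho>(2) by simp
  qed
  have "emeasure lborel (cball (0::complex) \<rho>) * I
      \<le> (\<integral>\<^sup>+x\<in>ball p (2 * (r / 2)). (\<integral>\<^sup>+s\<in>cball 0 \<rho>. weight q (F (x + e s)) \<partial>lborel) \<partial>lborel)"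
    unfolding I_def by (rule nn_integral_average_translates_le) (use small in auto)
  also have "\<dots> \<le> (\<integral>\<^sup>+x\<in>ball p r. J \<partial>lborel)"
    using line by (intro nn_integral_mono) (auto simp: indicator_def)
  also have "\<dots> = J * emeasure lborel (ball p r)" by (simp add: nn_integral_cmult)
  also have "\<dots> < \<infinity>"
    using nn_integral_weight_cball_finite[OF q, of "2 * \<rho>"]
      weight_less_top[of "of_real (c / 2)" q] pos(1) emeasure_lborel_ball_finite[of p r]
    by (auto simp: J_def ennreal_mult_less_top)
  finally have "emeasure lborel (cball (0::complex) \<rho>) * I < \<infinity>" .
  moreover have "emeasure lborel (cball (0::complex) \<rho>) \<noteq> 0"
    using \<rho>(1) by (simp add: emeasure_cball unit_ball_vol_2)
  ultimately have "I < \<infinity>" by (auto simp: ennreal_mult_less_top)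
  then show ?thesis
    unfolding weight_integrable_at_def I_def using pos(2) by (intro exI[of _ "ball p (r / 2)"]) auto
qed

lemma nn_integral_weight_compact_finite:
  assumes F: "continuous_on UNIV F" and K: "compact K"
    and loc: "\<And>p. p \<in> K \<Longrightarrow> weight_integrable_at q F p"
  shows "(\<integral>\<^sup>+x\<in>K. weight q (F x) \<partial>lborel) < \<infinity>"
proof -
  have [measurable]: "F \<in> borel_measurable borel" using F by (rule borel_measurable_continuous_onI)
  obtain U where U: "\<And>p. p \<in> K \<Longrightarrow> open (U p)" "\<And>p. p \<in> K \<Longrightarrow> p \<in> U p"
    "\<And>p. p \<in> K \<Longrightarrow> (\<integral>\<^sup>+x\<in>U p. weight q (F x) \<partial>lborel) < \<infinity>"
    using loc unfolding weight_integrable_at_def by metis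
  obtain T where T: "T \<subseteq> K" "finite T" "K \<subseteq> (\<Union>p\<in>T. U p)"
    by (rule compactE_image[OF K, of K U]) (use U in blast)+
  have [measurable]: "U p \<in> sets borel" if "p \<in> T" for p
    using U(1) T(1) that by (meson borel_open subsetD)
  have "(\<integral>\<^sup>+x\<in>K. weight q (F x) \<partial>lborel) \<le> (\<integral>\<^sup>+x. (\<Sum>p\<in>T. weight q (F x) * indicator (U p) x) \<partial>lborel)"
  proof (rule nn_integral_mono)
    fix x
    show "weight q (F x) * indicator K x \<le> (\<Sum>p\<in>T. weight q (F x) * indicator (U p) x)"
    proof (cases "x \<in> K")
      case True
      then obtain p where p: "p \<in> T" "x \<in> U p" using T(3) by blast
      have "weight q (F x) * indicator (U p) x \<le> (\<Sum>p\<in>T. weight q (F x) * indicator (U p) x)"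
        by (rule member_le_sum[OF p(1)]) (use T in auto)
      then show ?thesis using True p by simp
    qed simp
  qed
  also have "\<dots> = (\<Sum>p\<in>T. (\<integral>\<^sup>+x\<in>U p. weight q (F x) \<partial>lborel))"
    by (rule nn_integral_sum) auto
  also have "\<dots> < \<infinity>" using U(3) T by (simp add: subset_iff)
  finally show ?thesis .
qed

subsection \<open>The normal forms\<close>

text \<open>Each normal form contains a product \<open>a b\<close> of two smooth branches at distance \<open>2 |c|\<close>. Moving
  half of the exponent of the larger factor to \<open>c\<close> leaves the exponent \<open>3 s\<close> on every factor, which
  is below the critical value \<open>2\<close> exactly if \<open>s < 2 / 3\<close>.\<close>

lemma weight_product_le:
  assumes s: "s \<ge> 0" and c: "norm c \<le> norm a \<or> norm c \<le> norm b"
  shows "weight (2 * s) (a * b) \<le> weight s c * (weight (3 * s) a + weight (3 * s) b)"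
proof -
  have ordered: "weight (2 * s) (a * b) \<le> weight s c * weight (3 * s) a"
    if "norm a \<le> norm b" "norm c \<le> norm b" for a b
  proof -
    have "weight (2 * s) (a * b) = weight (2 * s) a * (weight s b * weight s b)"
      by (simp add: weight_mult weight_add_exponent[symmetric])
    also have "\<dots> \<le> weight (2 * s) a * (weight s a * weight s c)"
      using that s by (intro mult_mono weight_antimono) auto
    also have "\<dots> = weight s c * weight (3 * s) a"
      using weight_add_exponent[of "2 * s" s a] by (simp add: mult_ac)
    finally show ?thesis .
  qed
  consider "norm a \<le> norm b" "norm c \<le> norm b" | "norm b \<le> norm a" "norm c \<le> norm a"
    using c by linarith
  then show ?thesis
  proof cases
    case 1
    then show ?thesis using ordered[of a b] by (auto simp: distrib_left intro: order_trans)
  next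
    case 2
    then show ?thesis
      using ordered[of b a] by (auto simp: distrib_left mult.commute[of a b] intro: order_trans)
  qed
qed

lemma weight_sum_of_squares_le:
  assumes s: "s \<ge> 0"
  shows "weight (2 * s) (x\<^sup>2 + c\<^sup>2)
      \<le> weight s c * (weight (3 * s) (x + \<i> * c) + weight (3 * s) (x + - \<i> * c))"
proof -
  have "x\<^sup>2 + c\<^sup>2 = (x + \<i> * c) * (x + - \<i> * c)" by (simp add: algebra_simps power2_eq_square)
  moreover have "2 * norm c \<le> norm (x + \<i> * c) + norm (x + - \<i> * c)"
    using norm_triangle_ineq4[of "x + \<i> * c" "x + - \<i> * c"] by (simp add: norm_mult)
  then have "norm c \<le> norm (x + \<i> * c) \<or> norm c \<le> norm (x + - \<i> * c)" by linarith
  ultimately show ?thesis using weight_product_le[OF s] by metis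
qed

lemma nn_integral_ball_Pair_le:
  fixes g :: "'a::euclidean_space \<times> 'b::euclidean_space \<Rightarrow> ennreal"
  assumes "g \<in> borel_measurable borel"
  shows "(\<integral>\<^sup>+z\<in>ball (a, b) r. g z \<partial>lborel)
      \<le> (\<integral>\<^sup>+y\<in>cball b r. (\<integral>\<^sup>+x\<in>cball a r. g (x, y) \<partial>lborel) \<partial>lborel)"
proof -
  have [measurable]: "g \<in> borel_measurable (borel \<Otimes>\<^sub>M borel)" using assms by (simp add: borel_prod)
  have "(\<integral>\<^sup>+z\<in>ball (a, b) r. g z \<partial>lborel)
      \<le> (\<integral>\<^sup>+z. g z * indicator (cball a r) (fst z)
          * indicator (cball b r) (snd z) \<partial>(lborel \<Otimes>\<^sub>M lborel))"
    unfolding lborel_prod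
  proof (rule nn_integral_mono)
    fix z :: "'a \<times> 'b"
    have "fst z \<in> cball a r" "snd z \<in> cball b r" if "z \<in> ball (a, b) r"
      using that dist_fst_le[of "(a, b)" z] dist_snd_le[of "(a, b)" z] by auto
    then show "g z * indicator (ball (a, b) r) z
        \<le> g z * indicator (cball a r) (fst z) * indicator (cball b r) (snd z)"
      by (auto simp: indicator_def)
  qed
  also have "\<dots> = (\<integral>\<^sup>+y\<in>cball b r. (\<integral>\<^sup>+x\<in>cball a r. g (x, y) \<partial>lborel) \<partial>lborel)"
    by (subst lborel_pair.nn_integral_snd[symmetric]) (auto simp: nn_integral_multc)
  finally show ?thesis .
qed

lemma weight_integrable_at_0_if_weight_le:
  fixes g :: "complex \<times> complex \<Rightarrow> complex" and c :: "complex \<Rightarrow> complex"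
  assumes s: "0 \<le> s" "s < 2 / 3"
    and [measurable]: "g \<in> borel_measurable borel" "c \<in> borel_measurable borel"
    and c: "\<And>y. norm y \<le> 1 \<Longrightarrow> norm (c y) \<le> 1"
    and le: "\<And>x y. norm y \<le> 1 \<Longrightarrow> weight (2 * s) (g (x, y))
      \<le> weight (3 * s) y * (weight (3 * s) (x + \<i> * c y) + weight (3 * s) (x + - \<i> * c y))"
  shows "weight_integrable_at (2 * s) g (0, 0)"
proof -
  define w where "w = weight (3 * s)"
  define J where "J = (\<integral>\<^sup>+t\<in>cball 0 2. w t \<partial>lborel)"
  have [measurable]: "w \<in> borel_measurable borel" by (simp add: w_def)
  have translate: "(\<integral>\<^sup>+x\<in>cball 0 1. w (x + d) \<partial>lborel) \<le> J" if "norm d \<le> 1" for d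
    unfolding J_def w_def using that
    by (intro order_trans[OF nn_integral_weight_translate_le] nn_integral_mono)
        (auto simp: indicator_def)
  have slice: "(\<integral>\<^sup>+x\<in>cball 0 1. weight (2 * s) (g (x, y)) \<partial>lborel) \<le> w y * (J + J)"
    if y: "norm y \<le> 1" for y
  proof -
    have "(\<integral>\<^sup>+x\<in>cball 0 1. weight (2 * s) (g (x, y)) \<partial>lborel)
        \<le> (\<integral>\<^sup>+x. w y * (w (x + \<i> * c y) * indicator (cball 0 1) x
            + w (x + - \<i> * c y) * indicator (cball 0 1) x) \<partial>lborel)"
      using le[OF y] by (intro nn_integral_mono) (auto simp: w_def indicator_def)
    also have "\<dots> = w y * ((\<integral>\<^sup>+x\<in>cball 0 1. w (x + \<i> * c y) \<partial>lborel)
        + (\<integral>\<^sup>+x\<in>cball 0 1. w (x + - \<i> * c y) \<partial>lborel))"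
      by (subst nn_integral_cmult, simp, subst nn_integral_add) auto
    also have "\<dots> \<le> w y * (J + J)"
      using c[OF y] by (intro mult_left_mono add_mono translate) (auto simp: norm_mult)
    finally show ?thesis .
  qed
  have "(\<integral>\<^sup>+z\<in>ball (0, 0) 1. weight (2 * s) (g z) \<partial>lborel)
      \<le> (\<integral>\<^sup>+y\<in>cball 0 1. (\<integral>\<^sup>+x\<in>cball 0 1. weight (2 * s) (g (x, y)) \<partial>lborel) \<partial>lborel)"
    by (rule nn_integral_ball_Pair_le) measurable
  also have "\<dots> \<le> (\<integral>\<^sup>+y. w y * indicator (cball 0 1) y * (J + J) \<partial>lborel)"
    using slice by (intro nn_integral_mono) (auto simp: indicator_def)
  also have "\<dots> = (\<integral>\<^sup>+y\<in>cball 0 1. w y \<partial>lborel) * (J + J)"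
    by (rule nn_integral_multc) simp
  also have "\<dots> < \<infinity>"
    using nn_integral_weight_cball_finite[of "3 * s"] s
    by (auto simp: ennreal_mult_less_top w_def J_def)
  finally show ?thesis
    unfolding weight_integrable_at_def by (intro exI[of _ "ball (0, 0) 1"]) auto
qed

lemma continuous_on_nf: "continuous_on S nf_A1" "continuous_on S nf_A5" "continuous_on S nf_D4"
  unfolding nf_A1_def[abs_def] nf_A5_def[abs_def] nf_D4_def[abs_def] by (intro continuous_intros)+

lemma weight_integrable_at_nf_A1: "0 \<le> s \<Longrightarrow> s < 2 / 3 \<Longrightarrow> weight_integrable_at (2 * s) nf_A1 (0, 0)"
proof (rule weight_integrable_at_0_if_weight_le[where c = "\<lambda>y. y"])
  fix x y :: complex assume s: "0 \<le> s" and y: "norm y \<le> 1"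
  have "weight (2 * s) (nf_A1 (x, y))
      \<le> weight s y * (weight (3 * s) (x + \<i> * y) + weight (3 * s) (x + - \<i> * y))"
    using weight_sum_of_squares_le[OF s, of x y] by (simp add: nf_A1_def)
  also have "\<dots> \<le> weight (3 * s) y * (weight (3 * s) (x + \<i> * y) + weight (3 * s) (x + - \<i> * y))"
    using s y by (intro mult_right_mono weight_mono_exponent) auto
  finally show "weight (2 * s) (nf_A1 (x, y))
    \<le> weight (3 * s) y * (weight (3 * s) (x + \<i> * y) + weight (3 * s) (x + - \<i> * y))" .
qed (auto intro: borel_measurable_continuous_onI continuous_on_nf)

lemma weight_integrable_at_nf_A5: "0 \<le> s \<Longrightarrow> s < 2 / 3 \<Longrightarrow> weight_integrable_at (2 * s) nf_A5 (0, 0)"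
proof (rule weight_integrable_at_0_if_weight_le[where c = "\<lambda>y. y ^ 3"])
  fix x y :: complex assume s: "0 \<le> s"
  show "weight (2 * s) (nf_A5 (x, y))
    \<le> weight (3 * s) y * (weight (3 * s) (x + \<i> * y ^ 3) + weight (3 * s) (x + - \<i> * y ^ 3))"
    using weight_sum_of_squares_le[OF s, of x "y ^ 3"]
    by (simp add: nf_A5_def weight_cube power_mult[symmetric])
qed (auto simp: norm_power power_le_one intro: borel_measurable_continuous_onI continuous_on_nf)

lemma weight_integrable_at_nf_D4: "0 \<le> s \<Longrightarrow> s < 2 / 3 \<Longrightarrow> weight_integrable_at (2 * s) nf_D4 (0, 0)"
proof (rule weight_integrable_at_0_if_weight_le[where c = "\<lambda>y. y"])
  fix x y :: complex assume s: "0 \<le> s"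
  have "nf_D4 (x, y) = y * (x\<^sup>2 + y\<^sup>2)"
    by (simp add: nf_D4_def algebra_simps power2_eq_square power3_eq_cube)
  then have "weight (2 * s) (nf_D4 (x, y)) = weight (2 * s) y * weight (2 * s) (x\<^sup>2 + y\<^sup>2)"
    by (simp add: weight_mult)
  also have "\<dots> \<le> weight (2 * s) y *
      (weight s y * (weight (3 * s) (x + \<i> * y) + weight (3 * s) (x + - \<i> * y)))"
    by (intro mult_left_mono weight_sum_of_squares_le s) auto
  also have "\<dots> = weight (3 * s) y * (weight (3 * s) (x + \<i> * y) + weight (3 * s) (x + - \<i> * y))"
    using weight_add_exponent[of "2 * s" s y] by (simp add: mult.assoc)
  finally show "weight (2 * s) (nf_D4 (x, y))
    \<le> weight (3 * s) y * (weight (3 * s) (x + \<i> * y) + weight (3 * s) (x + - \<i> * y))" .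
qed (auto intro: borel_measurable_continuous_onI continuous_on_nf)

subsection \<open>Coordinates on complex three-space\<close>

definition scl :: "complex \<Rightarrow> pt \<Rightarrow> pt" where
  "scl \<mu> v = (\<mu> * px v, \<mu> * py v, \<mu> * pz v)"

definition cnj3 :: "pt \<Rightarrow> pt" where
  "cnj3 v = (cnj (px v), cnj (py v), cnj (pz v))"

definition dot3 :: "pt \<Rightarrow> pt \<Rightarrow> complex" (infixl "\<odot>" 70) where
  "u \<odot> v = px u * px v + py u * py v + pz u * pz v"

lemma pt_simps [simp]:
  "px (a, b, c) = a" "py (a, b, c) = b" "pz (a, b, c) = c"
  "px 0 = 0" "py 0 = 0" "pz 0 = 0"
  "px (v + w) = px v + px w" "py (v + w) = py v + py w" "pz (v + w) = pz v + pz w"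
  "px (v - w) = px v - px w" "py (v - w) = py v - py w" "pz (v - w) = pz v - pz w"
  "px (scl \<mu> v) = \<mu> * px v" "py (scl \<mu> v) = \<mu> * py v" "pz (scl \<mu> v) = \<mu> * pz v"
  "px (cnj3 v) = cnj (px v)" "py (cnj3 v) = cnj (py v)" "pz (cnj3 v) = cnj (pz v)"
  by (simp_all add: px_def py_def pz_def scl_def cnj3_def)

lemma pt_eta [simp]: "(px v, py v, pz v) = v"
  by (simp add: px_def py_def pz_def)

lemma pt_eqI: "px v = px w \<Longrightarrow> py v = py w \<Longrightarrow> pz v = pz w \<Longrightarrow> v = w"
  by (metis pt_eta)

lemma bounded_linear_coordinates: "bounded_linear px" "bounded_linear py" "bounded_linear pz"
  unfolding px_def[abs_def] py_def[abs_def] pz_def[abs_def]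
  by (rule bounded_linear_fst bounded_linear_snd
      bounded_linear_compose[OF bounded_linear_fst bounded_linear_snd]
      bounded_linear_compose[OF bounded_linear_snd bounded_linear_snd])+

lemma continuous_on_coordinates [continuous_intros]:
  "continuous_on S g \<Longrightarrow> continuous_on S (\<lambda>x. px (g x))"
  "continuous_on S g \<Longrightarrow> continuous_on S (\<lambda>x. py (g x))"
  "continuous_on S g \<Longrightarrow> continuous_on S (\<lambda>x. pz (g x))"
  using bounded_linear_coordinates by (auto intro: bounded_linear.continuous_on)

lemma continuous_on_scl [continuous_intros]:
  "continuous_on S f \<Longrightarrow> continuous_on S g \<Longrightarrow> continuous_on S (\<lambda>x. scl (f x) (g x))"
  unfolding scl_def by (intro continuous_intros)

lemma continuous_on_cnj3 [continuous_intros]: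
  "continuous_on S g \<Longrightarrow> continuous_on S (\<lambda>x. cnj3 (g x))"
  unfolding cnj3_def by (intro continuous_intros)

lemma continuous_on_dot3 [continuous_intros]:
  "continuous_on S f \<Longrightarrow> continuous_on S g \<Longrightarrow> continuous_on S (\<lambda>x. f x \<odot> g x)"
  unfolding dot3_def by (intro continuous_intros)

lemma continuous_on_chart [continuous_intros]:
  "continuous_on S g \<Longrightarrow> continuous_on S (\<lambda>x. chart p v w (g x))"
  unfolding chart_def by (intro continuous_intros)

lemma bounded_linear_scl_right: "bounded_linear (scl \<mu>)"
  unfolding scl_def[abs_def]
  by (intro bounded_linear_Pair bounded_linear_const_mult bounded_linear_coordinates)

lemma bounded_linear_scl_left: "bounded_linear (\<lambda>\<mu>. scl \<mu> v)"
  unfolding scl_def by (intro bounded_linear_Pair bounded_linear_mult_left)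

lemma dot3_commute: "u \<odot> v = v \<odot> u"
  by (simp add: dot3_def mult.commute)

lemma dot3_simps [simp]:
  "0 \<odot> v = 0" "u \<odot> 0 = 0" "(u + v) \<odot> w = u \<odot> w + v \<odot> w" "u \<odot> (v + w) = u \<odot> v + u \<odot> w"
  "scl \<mu> u \<odot> v = \<mu> * (u \<odot> v)" "u \<odot> scl \<mu> v = \<mu> * (u \<odot> v)"
  by (simp_all add: dot3_def algebra_simps)

lemma scl_simps [simp]: "scl 0 v = 0" "scl 1 v = v" "scl \<mu> 0 = 0" "scl \<mu> (scl \<nu> v) = scl (\<mu> * \<nu>) v"
  by (auto intro: pt_eqI)

lemma cnj3_scl [simp]: "cnj3 (scl \<mu> v) = scl (cnj \<mu>) (cnj3 v)"
  by (rule pt_eqI) simp_all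

lemma scl_of_real: "scl (of_real t) v = t *\<^sub>R v"
  by (cases v) (auto simp: scl_def scaleR_conv_of_real)

lemma inner_eq_Re_dot3: "v \<bullet> w = Re (v \<odot> cnj3 w)"
  by (cases v; cases w) (simp add: dot3_def inner_prod_def inner_complex_def)

lemma norm_pt_squared: "(norm v)\<^sup>2 = (norm (px v))\<^sup>2 + (norm (py v))\<^sup>2 + (norm (pz v))\<^sup>2"
  by (cases v) (simp add: norm_Pair)

lemma dot3_cnj3_self: "v \<odot> cnj3 v = of_real ((norm v)\<^sup>2)"
  by (simp only: norm_pt_squared of_real_add complex_norm_square dot3_def pt_simps)

lemma norm_scl: "norm (scl \<mu> v) = norm \<mu> * norm v"
proof (rule power2_eq_imp_eq)
  show "(norm (scl \<mu> v))\<^sup>2 = (norm \<mu> * norm v)\<^sup>2"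
    by (simp add: norm_pt_squared norm_mult power_mult_distrib distrib_left)
qed auto

subsection \<open>Holomorphic functions and vector fields\<close>

definition grad :: "(pt \<Rightarrow> complex) \<Rightarrow> pt \<Rightarrow> pt" where
  "grad f v = (dX f v, dY f v, dZ f v)"

lemma grad_eqI:
  assumes "(f has_derivative (\<odot>) u) (at v)"
  shows "grad f v = u"
proof -
  have "((\<lambda>t. f (t, py v, pz v)) has_derivative (\<lambda>h. u \<odot> (h, 0, 0))) (at (px v))"
    by (rule has_derivative_compose[where g = f and f' = "\<lambda>h. (h, 0, 0)"])
       (auto intro!: derivative_eq_intros assms simp: zero_prod_def)
  moreover have "((\<lambda>t. f (px v, t, pz v)) has_derivative (\<lambda>h. u \<odot> (0, h, 0))) (at (py v))"
    by (rule has_derivative_compose[where g = f and f' = "\<lambda>h. (0, h, 0)"])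
       (auto intro!: derivative_eq_intros assms simp: zero_prod_def)
  moreover have "((\<lambda>t. f (px v, py v, t)) has_derivative (\<lambda>h. u \<odot> (0, 0, h))) (at (pz v))"
    by (rule has_derivative_compose[where g = f and f' = "\<lambda>h. (0, 0, h)"])
       (auto intro!: derivative_eq_intros assms simp: zero_prod_def)
  ultimately show ?thesis
    by (simp add: grad_def dX_def dY_def dZ_def dot3_def DERIV_imp_deriv has_field_derivative_def)
qed

definition holo3 :: "(pt \<Rightarrow> complex) \<Rightarrow> bool" where
  "holo3 f \<longleftrightarrow> (\<forall>v. (f has_derivative (\<odot>) (grad f v)) (at v)) \<and> continuous_on UNIV (grad f)"

lemma holo3I:
  assumes "\<And>v. (f has_derivative (\<odot>) (A v)) (at v)" "continuous_on UNIV A"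
  shows "holo3 f" "grad f = A"
proof -
  show "grad f = A" using grad_eqI[OF assms(1)] by auto
  then show "holo3 f" using assms by (simp add: holo3_def)
qed

lemma holo3D:
  assumes "holo3 f"
  shows holo3_has_derivative: "(f has_derivative (\<odot>) (grad f v)) (at v)"
    and holo3_continuous_on: "continuous_on S f"
    and holo3_continuous_on_grad: "continuous_on S (grad f)"
proof -
  show D: "(f has_derivative (\<odot>) (grad f v)) (at v)" for v using assms unfolding holo3_def by blast
  show "continuous_on S f"
    by (intro continuous_at_imp_continuous_on ballI has_derivative_continuous[OF D])
  show "continuous_on S (grad f)" using assms continuous_on_subset by (auto simp: holo3_def)
qed

lemma holo3_const: "holo3 (\<lambda>_. k)" "grad (\<lambda>_. k) = (\<lambda>_. 0)"
proof -
  have "((\<odot>) 0) = (\<lambda>_. 0)" by auto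
  then have "((\<lambda>_. k) has_derivative (\<odot>) 0) (at v)" for v by simp
  then show "holo3 (\<lambda>_. k)" "grad (\<lambda>_. k) = (\<lambda>_. 0)" using holo3I[of "\<lambda>_. k" "\<lambda>_. 0"] by auto
qed

lemma holo3_coordinates:
  shows "holo3 px" "grad px = (\<lambda>_. (1, 0, 0))"
    and "holo3 py" "grad py = (\<lambda>_. (0, 1, 0))"
    and "holo3 pz" "grad pz = (\<lambda>_. (0, 0, 1))"
proof -
  have "px = (\<odot>) (1, 0, 0)" "py = (\<odot>) (0, 1, 0)" "pz = (\<odot>) (0, 0, 1)"
    by (auto simp: dot3_def)
  then have "(px has_derivative (\<odot>) (1, 0, 0)) (at v)" "(py has_derivative (\<odot>) (0, 1, 0)) (at v)"
    "(pz has_derivative (\<odot>) (0, 0, 1)) (at v)" for v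
    by (metis bounded_linear_imp_has_derivative bounded_linear_coordinates)+
  then show "holo3 px" "grad px = (\<lambda>_. (1, 0, 0))" "holo3 py" "grad py = (\<lambda>_. (0, 1, 0))"
    "holo3 pz" "grad pz = (\<lambda>_. (0, 0, 1))"
    using holo3I[of px "\<lambda>_. (1, 0, 0)"] holo3I[of py "\<lambda>_. (0, 1, 0)"] holo3I[of pz "\<lambda>_. (0, 0, 1)"]
    by auto
qed

lemma holo3_add:
  assumes f: "holo3 f" and g: "holo3 g"
  shows "holo3 (\<lambda>v. f v + g v)" "grad (\<lambda>v. f v + g v) = (\<lambda>v. grad f v + grad g v)"
proof -
  have D: "((\<lambda>v. f v + g v) has_derivative (\<odot>) (grad f v + grad g v)) (at v)" for v
    using has_derivative_add[OF holo3_has_derivative[OF f] holo3_has_derivative[OF g]]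
    by (rule has_derivative_eq_rhs) auto
  have "continuous_on UNIV (\<lambda>v. grad f v + grad g v)"
    by (intro continuous_intros holo3_continuous_on_grad f g)
  then show "holo3 (\<lambda>v. f v + g v)" "grad (\<lambda>v. f v + g v) = (\<lambda>v. grad f v + grad g v)"
    using holo3I[OF D] by auto
qed

lemma holo3_mult:
  assumes f: "holo3 f" and g: "holo3 g"
  shows "holo3 (\<lambda>v. f v * g v)"
    "grad (\<lambda>v. f v * g v) = (\<lambda>v. scl (g v) (grad f v) + scl (f v) (grad g v))"
proof -
  have D: "((\<lambda>v. f v * g v) has_derivative
      (\<odot>) (scl (g v) (grad f v) + scl (f v) (grad g v))) (at v)" for v
    using has_derivative_mult[OF holo3_has_derivative[OF f] holo3_has_derivative[OF g]]
    by (rule has_derivative_eq_rhs) (auto simp: algebra_simps)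
  have "continuous_on UNIV (\<lambda>v. scl (g v) (grad f v) + scl (f v) (grad g v))"
    by (intro continuous_intros holo3_continuous_on holo3_continuous_on_grad f g)
  then show "holo3 (\<lambda>v. f v * g v)"
    "grad (\<lambda>v. f v * g v) = (\<lambda>v. scl (g v) (grad f v) + scl (f v) (grad g v))"
    using holo3I[OF D] by auto
qed

text \<open>An inductive description of polynomial functions makes closure under partial derivatives a
  rule induction.\<close>

inductive polyfun :: "(pt \<Rightarrow> complex) \<Rightarrow> bool" where
  const: "polyfun (\<lambda>_. k)"
| x: "polyfun px" | y: "polyfun py" | z: "polyfun pz"
| add: "polyfun f \<Longrightarrow> polyfun g \<Longrightarrow> polyfun (\<lambda>v. f v + g v)"
| mult: "polyfun f \<Longrightarrow> polyfun g \<Longrightarrow> polyfun (\<lambda>v. f v * g v)"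

lemma polyfun_holo3: "polyfun f \<Longrightarrow> holo3 f"
  by (induction rule: polyfun.induct)
     (auto intro: holo3_const holo3_coordinates holo3_add holo3_mult)

lemma polyfun_partials: "polyfun f \<Longrightarrow> polyfun (dX f) \<and> polyfun (dY f) \<and> polyfun (dZ f)"
proof -
  assume "polyfun f"
  then have "polyfun (\<lambda>v. px (grad f v)) \<and> polyfun (\<lambda>v. py (grad f v))
      \<and> polyfun (\<lambda>v. pz (grad f v))"
    by (induction rule: polyfun.induct)
       (auto simp: holo3_const holo3_coordinates holo3_add holo3_mult polyfun_holo3
         intro!: polyfun.intros)
  then show ?thesis by (simp add: grad_def[abs_def])
qed

lemma polyfun_sum: "(\<And>i. i \<in> I \<Longrightarrow> polyfun (F i)) \<Longrightarrow> polyfun (\<lambda>v. \<Sum>i\<in>I. F i v)"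
  by (induction I rule: infinite_finite_induct) (auto intro: polyfun.intros)

lemma polyfun_prod: "(\<And>i. i \<in> I \<Longrightarrow> polyfun (F i)) \<Longrightarrow> polyfun (\<lambda>v. \<Prod>i\<in>I. F i v)"
  by (induction I rule: infinite_finite_induct) (auto intro: polyfun.intros)

lemma polyfun_power: "polyfun f \<Longrightarrow> polyfun (\<lambda>v. f v ^ n)"
  by (induction n) (auto intro: polyfun.intros)

lemma homog_imp_polyfun: "homog m f \<Longrightarrow> polyfun f"
proof -
  assume "homog m f"
  then obtain c where c: "f = (\<lambda>v. \<Sum>e\<in>{e. c e \<noteq> 0}. c e * mono e v)"
    unfolding homog_def by blast
  show ?thesis
    unfolding c mono_def
    by (intro polyfun_sum polyfun.mult polyfun_power polyfun.const polyfun.x polyfun.y polyfun.z)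
qed

definition homogeneous :: "nat \<Rightarrow> (pt \<Rightarrow> complex) \<Rightarrow> bool" where
  "homogeneous m f \<longleftrightarrow> (\<forall>\<mu> v. f (scl \<mu> v) = \<mu> ^ m * f v)"

lemma homogeneousD: "homogeneous m f \<Longrightarrow> f (scl \<mu> v) = \<mu> ^ m * f v"
  unfolding homogeneous_def by blast

lemma homog_imp_homogeneous: "homog m f \<Longrightarrow> homogeneous m f"
proof -
  assume "homog m f"
  then obtain c where c: "\<And>v. f v = (\<Sum>e\<in>{e. c e \<noteq> 0}. c e * mono e v)" "\<And>e. c e \<noteq> 0 \<Longrightarrow> mdeg e = m"
    by (auto simp: homog_def)
  have "c e * mono e (scl \<mu> v) = \<mu> ^ m * (c e * mono e v)" if "c e \<noteq> 0" for e \<mu> v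
    using c(2)[OF that] by (auto simp: mono_def mdeg_def power_mult_distrib power_add)
  then show ?thesis unfolding homogeneous_def c(1) sum_distrib_left by (auto intro!: sum.cong)
qed

lemma homogeneous_mult: "homogeneous m f \<Longrightarrow> homogeneous n g \<Longrightarrow> homogeneous (m + n) (\<lambda>v. f v * g v)"
  unfolding homogeneous_def by (simp add: power_add)

lemma homogeneous_prod:
  "(\<And>i. i \<in> I \<Longrightarrow> homogeneous (m i) (F i)) \<Longrightarrow> homogeneous (\<Sum>i\<in>I. m i) (\<lambda>v. \<Prod>i\<in>I. F i v)"
  by (simp add: homogeneous_def prod.distrib power_sum)

lemma grad_homogeneous:
  assumes f: "holo3 f" "homogeneous m f"
  shows "scl \<mu> (grad f (scl \<mu> v)) = scl (\<mu> ^ m) (grad f v)"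
proof -
  have "((\<lambda>v. f (scl \<mu> v)) has_derivative (\<lambda>w. grad f (scl \<mu> v) \<odot> scl \<mu> w)) (at v)"
    by (rule has_derivative_compose[OF
          bounded_linear_imp_has_derivative[OF bounded_linear_scl_right]
          holo3_has_derivative[OF f(1)]])
  then have "((\<lambda>v. \<mu> ^ m * f v) has_derivative (\<odot>) (scl \<mu> (grad f (scl \<mu> v)))) (at v)"
    unfolding homogeneousD[OF f(2)] by (rule has_derivative_eq_rhs) auto
  moreover have "((\<lambda>v. \<mu> ^ m * f v) has_derivative (\<odot>) (scl (\<mu> ^ m) (grad f v))) (at v)"
    using has_derivative_mult_right[OF holo3_has_derivative[OF f(1)], of "\<mu> ^ m" v]
    by (rule has_derivative_eq_rhs) auto
  ultimately show ?thesis using grad_eqI by metis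
qed

lemma euler_identity:
  assumes f: "holo3 f" "homogeneous m f"
  shows "grad f v \<odot> v = of_nat m * f v"
proof -
  have "(f has_derivative (\<odot>) (grad f v)) (at (scl 1 v))"
    using holo3_has_derivative[OF f(1)] by simp
  then have "((\<lambda>\<mu>. f (scl \<mu> v)) has_derivative (\<lambda>k. grad f v \<odot> scl k v)) (at 1)"
    by (rule has_derivative_compose[OF
          bounded_linear_imp_has_derivative[OF bounded_linear_scl_left]])
  then have "((\<lambda>\<mu>. f (scl \<mu> v)) has_field_derivative (grad f v \<odot> v)) (at 1)"
    unfolding has_field_derivative_def by (rule has_derivative_eq_rhs) auto
  moreover have "((\<lambda>\<mu>. f (scl \<mu> v)) has_field_derivative (of_nat m * f v)) (at 1)"
    unfolding homogeneousD[OF f(2)] by (auto intro!: derivative_eq_intros)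
  ultimately show ?thesis by (rule DERIV_unique)
qed

definition coordinatewise :: "((pt \<Rightarrow> complex) \<Rightarrow> bool) \<Rightarrow> (pt \<Rightarrow> pt) \<Rightarrow> bool" where
  "coordinatewise P \<delta> \<longleftrightarrow> P (\<lambda>v. px (\<delta> v)) \<and> P (\<lambda>v. py (\<delta> v)) \<and> P (\<lambda>v. pz (\<delta> v))"

lemma coordinatewise_mono: "coordinatewise P \<delta> \<Longrightarrow> (\<And>f. P f \<Longrightarrow> Q f) \<Longrightarrow> coordinatewise Q \<delta>"
  by (auto simp: coordinatewise_def)

lemma coordinatewise_homogeneousD:
  "coordinatewise (homogeneous r) \<delta> \<Longrightarrow> \<delta> (scl \<mu> v) = scl (\<mu> ^ r) (\<delta> v)"
  unfolding coordinatewise_def by (rule pt_eqI) (use homogeneousD in fastforce)+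

lemma coordinatewise_holo3_continuous_on: "coordinatewise holo3 \<delta> \<Longrightarrow> continuous_on S \<delta>"
proof -
  assume "coordinatewise holo3 \<delta>"
  then have "continuous_on S (\<lambda>v. (px (\<delta> v), py (\<delta> v), pz (\<delta> v)))"
    by (intro continuous_intros holo3_continuous_on) (auto simp: coordinatewise_def)
  then show ?thesis by simp
qed

lemma coordinatewise_holo3_scl:
  "holo3 l \<Longrightarrow> coordinatewise holo3 \<delta> \<Longrightarrow> coordinatewise holo3 (\<lambda>v. scl (l v) (\<delta> v))"
  by (auto simp: coordinatewise_def intro: holo3_mult)

definition divergence :: "(pt \<Rightarrow> pt) \<Rightarrow> pt \<Rightarrow> complex" where
  "divergence \<delta> v = dX (\<lambda>v. px (\<delta> v)) v + dY (\<lambda>v. py (\<delta> v)) v + dZ (\<lambda>v. pz (\<delta> v)) v"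

lemma divergence_eq_grad:
  "divergence \<delta> v
      = px (grad (\<lambda>v. px (\<delta> v)) v) + py (grad (\<lambda>v. py (\<delta> v)) v) + pz (grad (\<lambda>v. pz (\<delta> v)) v)"
  by (simp add: divergence_def grad_def)

lemma divergence_scl:
  assumes "holo3 l" "coordinatewise holo3 \<delta>"
  shows "divergence (\<lambda>v. scl (l v) (\<delta> v)) v = l v * divergence \<delta> v + grad l v \<odot> \<delta> v"
  using assms by (simp add: divergence_eq_grad coordinatewise_def holo3_mult dot3_def algebra_simps)

lemma divergence_homogeneous:
  assumes "coordinatewise holo3 \<delta>" "coordinatewise (homogeneous r) \<delta>"
  shows "\<mu> * divergence \<delta> (scl \<mu> v) = \<mu> ^ r * divergence \<delta> v"
proof -
  have "\<mu> * px (grad f (scl \<mu> v)) = \<mu> ^ r * px (grad f v)"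
    "\<mu> * py (grad f (scl \<mu> v)) = \<mu> ^ r * py (grad f v)"
    "\<mu> * pz (grad f (scl \<mu> v)) = \<mu> ^ r * pz (grad f v)" if "holo3 f" "homogeneous r f" for f
    using grad_homogeneous[OF that, of \<mu> v] by (metis pt_simps)+
  then show ?thesis using assms by (simp add: divergence_eq_grad coordinatewise_def distrib_left)
qed

lemma polyfun_divergence: "coordinatewise polyfun \<delta> \<Longrightarrow> polyfun (divergence \<delta>)"
  unfolding divergence_def[abs_def] coordinatewise_def using polyfun_partials
  by (intro polyfun.add) auto

subsection \<open>Local integrability of the weight away from the origin\<close>

lemma holo2_line_has_field_derivative:
  assumes F: "holo2 F V" and z: "z + (s * a, s * b) \<in> V"
    and D: "(F has_derivative D) (at (z + (s * a, s * b)))"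
  shows "((\<lambda>s. F (z + (s * a, s * b))) has_field_derivative D (a, b)) (at s)"
proof -
  obtain D' where D': "(F has_derivative D') (at (z + (s * a, s * b)))"
    "\<And>c a b. D' (c * a, c * b) = c * D' (a, b)"
    using F z unfolding holo2_def by blast
  have "D (h * a, h * b) = D (a, b) * h" for h
    using D'(2)[of h a b] has_derivative_unique[OF D D'(1)] by (simp add: mult.commute)
  moreover have "((\<lambda>s. z + (s * a, s * b)) has_derivative (\<lambda>h. (h * a, h * b))) (at s)"
    by (auto intro!: derivative_eq_intros)
  then have "((\<lambda>s. F (z + (s * a, s * b))) has_derivative (\<lambda>h. D (h * a, h * b))) (at s)"
    by (rule has_derivative_compose) (rule D)
  ultimately show ?thesis unfolding has_field_derivative_def by (auto intro: has_derivative_eq_rhs)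
qed

text \<open>Cauchy's estimate on the complex line through \<open>z\<close> in the direction \<open>u\<close>.\<close>

lemma holo2_derivative_bound:
  assumes F: "holo2 F V" "(F has_derivative D) (at z)"
    and r: "r > 0" "cball z r \<subseteq> V" and M: "\<And>w. w \<in> cball z r \<Longrightarrow> norm (F w) < M"
  shows "norm (D u) \<le> M / r * norm u"
proof (cases "u = 0")
  case True
  then show ?thesis using linear_0[OF has_derivative_linear[OF F(2)]] by simp
next
  case False
  define h where "h s = F (z + (s * fst u, s * snd u))" for s
  define \<rho> where "\<rho> = r / norm u"
  have \<rho>: "\<rho> > 0" using r(1) False by (simp add: \<rho>_def)
  have line: "z + (s * fst u, s * snd u) \<in> cball z r" if "s \<in> cball 0 \<rho>" for s
  proof -
    have "norm (s * fst u, s * snd u) = norm s * norm u"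
      by (cases u)
         (simp add: norm_Pair norm_mult power_mult_distrib real_sqrt_mult flip: distrib_left)
    also have "\<dots> \<le> r" using that False by (simp add: \<rho>_def field_simps)
    finally have "dist (z + (s * fst u, s * snd u)) z \<le> r" by (simp add: dist_norm)
    then show ?thesis by (simp add: dist_commute)
  qed
  have diff: "h field_differentiable at s" if "s \<in> cball 0 \<rho>" for s
  proof -
    have V: "z + (s * fst u, s * snd u) \<in> V" using line[OF that] r(2) by blast
    then obtain D' where "(F has_derivative D') (at (z + (s * fst u, s * snd u)))"
      using F(1) unfolding holo2_def by blast
    from holo2_line_has_field_derivative[OF F(1) V this] show ?thesis
      unfolding h_def[abs_def] field_differentiable_def by blast
  qed
  have "norm ((deriv ^^ 1) h 0) \<le> fact 1 * M / \<rho> ^ 1"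
  proof (rule Cauchy_higher_deriv_bound[where y = 0])
    show "continuous_on (cball 0 \<rho>) h"
      using diff
      by (intro continuous_at_imp_continuous_on ballI field_differentiable_imp_continuous_at)
    show "h holomorphic_on ball 0 \<rho>"
      using diff by (auto simp: holomorphic_on_def intro: field_differentiable_at_within)
    show "h s \<in> ball 0 M" if "s \<in> ball 0 \<rho>" for s
      using M[OF line[of s]] that by (simp add: h_def)
  qed (use \<rho> in auto)
  moreover have "deriv h 0 = D u"
    using holo2_line_has_field_derivative[OF F(1), of z 0 "fst u" "snd u" D] F(2)
      r subsetD[OF r(2), of z]
    by (intro DERIV_imp_deriv) (simp add: h_def[abs_def] flip: zero_prod_def)
  ultimately show ?thesis by (simp add: \<rho>_def)
qed

lemma holo2_continuous_on: "holo2 F V \<Longrightarrow> continuous_on V F"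
  unfolding holo2_def
  by (rule continuous_at_imp_continuous_on, rule ballI, auto dest!: bspec has_derivative_continuous)

lemma holo2_lipschitz:
  assumes F: "holo2 F V" and z: "z \<in> V"
  obtains r L where "r > 0" "ball z r \<subseteq> V" "L-lipschitz_on (ball z r) F"
proof -
  have "open V" using F by (simp add: holo2_def)
  then obtain e where e: "e > 0" "cball z e \<subseteq> V" using z by (meson open_contains_cball)
  define r where "r = e / 2"
  have r: "r > 0" using e(1) by (simp add: r_def)
  have sub: "cball x r \<subseteq> cball z e" if "x \<in> ball z r" for x
  proof
    fix y assume "y \<in> cball x r"
    then show "y \<in> cball z e" using that dist_triangle[of z y x] by (simp add: r_def)
  qed
  have "bounded (F ` cball z e)"
    by (intro compact_imp_bounded compact_continuous_image
        continuous_on_subset[OF holo2_continuous_on[OF F]] e) auto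
  then obtain M where M: "M > 0" "\<And>w. w \<in> cball z e \<Longrightarrow> norm (F w) < M"
    unfolding bounded_pos_less by blast
  obtain D where D: "\<And>w. w \<in> V \<Longrightarrow> (F has_derivative D w) (at w)"
    using F unfolding holo2_def by metis
  have "ball z r \<subseteq> V" using sub r e(2) by force
  moreover have "(M / r)-lipschitz_on (ball z r) F"
  proof (rule bounded_derivative_imp_lipschitz)
    fix x assume x: "x \<in> ball z r"
    then have "x \<in> V" using \<open>ball z r \<subseteq> V\<close> by blast
    then show "(F has_derivative D x) (at x within ball z r)"
      by (rule has_derivative_at_withinI[OF D])
    show "onorm (D x) \<le> M / r"
    proof (rule onorm_bound)
      show "norm (D x u) \<le> M / r * norm u" for u
        by (rule holo2_derivative_bound[OF F D[OF \<open>x \<in> V\<close>] r]) (use sub[OF x] e(2) M in blast)+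
    qed (use M r in simp)
  qed (use M r in auto)
  ultimately show ?thesis using that r by blast
qed

lemma holo2_coordinates_lipschitz:
  assumes "holo2 (fst \<circ> \<phi>) V" "holo2 (snd \<circ> \<phi>) V" and z: "z \<in> V"
  obtains r L where "r > 0" "ball z r \<subseteq> V" "L-lipschitz_on (ball z r) \<phi>"
proof -
  obtain r1 L1 where r1: "r1 > 0" "ball z r1 \<subseteq> V" "L1-lipschitz_on (ball z r1) (fst \<circ> \<phi>)"
    using holo2_lipschitz[OF assms(1) z] .
  obtain r2 L2 where r2: "r2 > 0" "ball z r2 \<subseteq> V" "L2-lipschitz_on (ball z r2) (snd \<circ> \<phi>)"
    using holo2_lipschitz[OF assms(2) z] .
  have "(sqrt (L1\<^sup>2 + L2\<^sup>2))-lipschitz_on (ball z (min r1 r2)) (\<lambda>z. ((fst \<circ> \<phi>) z, (snd \<circ> \<phi>) z))"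
    by (intro lipschitz_on_Pair lipschitz_on_subset[OF r1(3)] lipschitz_on_subset[OF r2(3)]) auto
  then show ?thesis using r1 r2 by (intro that[of "min r1 r2"]) auto
qed

lemma weight_integrable_at_contact_equiv:
  assumes equiv: "contact_equiv F g"
    and [measurable]: "F \<in> borel_measurable borel" "g \<in> borel_measurable borel"
    and q: "q \<ge> 0" and loc: "weight_integrable_at q g (0, 0)"
  shows "weight_integrable_at q F (0, 0)"
proof -
  obtain U V \<phi> \<psi> u where "open U \<and> open V \<and> (0,0) \<in> V \<and> \<phi> (0,0) = (0,0) \<and>
      \<phi> ` V = U \<and> \<psi> ` U = V \<and> (\<forall>z\<in>V. \<psi> (\<phi> z) = z) \<and> (\<forall>w\<in>U. \<phi> (\<psi> w) = w) \<and>
      holo2 (fst \<circ> \<phi>) V \<and> holo2 (snd \<circ> \<phi>) V \<and> holo2 (fst \<circ> \<psi>) U \<and> holo2 (snd \<circ> \<psi>) U \<and>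
      holo2 u V \<and> (\<forall>z\<in>V. u z \<noteq> 0) \<and> (\<forall>z\<in>V. F (\<phi> z) = u z * g z)"
    using equiv unfolding contact_equiv_def by (elim exE)
  then have V: "open V" "(0, 0) \<in> V"
    and \<phi>: "\<phi> (0, 0) = (0, 0)" "holo2 (fst \<circ> \<phi>) V" "holo2 (snd \<circ> \<phi>) V"
    and inv: "\<And>z. z \<in> V \<Longrightarrow> \<psi> (\<phi> z) = z" and u: "holo2 u V" "u (0, 0) \<noteq> 0"
    and eq: "\<And>z. z \<in> V \<Longrightarrow> F (\<phi> z) = u z * g z"
    by blast+
  obtain r L where r: "r > 0" "ball (0, 0) r \<subseteq> V" "L-lipschitz_on (ball (0, 0) r) \<phi>"
    using holo2_coordinates_lipschitz[OF \<phi>(2,3) V(2)] .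
  define c where "c = norm (u (0, 0)) / 2"
  have "isCont u (0, 0)"
    using holo2_continuous_on[OF u(1)] V by (simp add: continuous_on_eq_continuous_at)
  then have "((\<lambda>z. norm (u z)) \<longlongrightarrow> norm (u (0, 0))) (nhds (0, 0))"
    by (simp add: isCont_def tendsto_at_iff_tendsto_nhds tendsto_norm)
  then have "\<forall>\<^sub>F z in nhds (0, 0). c < norm (u z)"
    by (rule order_tendstoD) (use u(2) in \<open>simp add: c_def\<close>)
  then obtain S where S: "open S" "(0, 0) \<in> S" "\<And>z. z \<in> S \<Longrightarrow> c < norm (u z)"
    by (auto simp: eventually_nhds)
  define N where "N = ball (0, 0) r \<inter> S"
  have N: "open N" "(0, 0) \<in> N" "N \<subseteq> V" using S r by (auto simp: N_def)
  have lip: "L-lipschitz_on N \<phi>" by (rule lipschitz_on_subset[OF r(3)]) (simp add: N_def)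
  have inj: "inj_on \<phi> N" using inv N(3) by (intro inj_on_inverseI[of _ \<psi>]) blast
  have "weight_integrable_at q F (\<phi> (0, 0))"
  proof (rule weight_integrable_at_lipschitz_image[OF q N(1,2) lip inj _ _ _ _ loc])
    show "c > 0" using u(2) by (simp add: c_def)
    fix x assume x: "x \<in> N"
    then have "c \<le> norm (u x)" "x \<in> V" using S(3)[of x] N(3) by (auto simp: N_def)
    then show "c * norm (g x) \<le> norm (F (\<phi> x))" by (simp add: eq norm_mult mult_right_mono)
  qed measurable
  then show ?thesis by (simp add: \<phi>(1))
qed

lemma chart_eq: "chart p v w st = p + scl (fst st) v + scl (snd st) w"
  by (rule pt_eqI) (simp_all add: chart_def)

lemma lipschitz_on_scl_chart:
  "(4 * (norm p + norm v + norm w))-lipschitz_on (ball 1 (1 / 2) \<times> ball (0, 0) 1)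
    (\<lambda>x. scl (fst x) (chart p v w (snd x)))"
proof (rule lipschitz_onI)
  let ?N = "norm p + norm v + norm w" and ?\<Phi> = "\<lambda>x. scl (fst x) (chart p v w (snd x))"
  fix x y :: "complex \<times> complex \<times> complex"
  assume x: "x \<in> ball 1 (1 / 2) \<times> ball (0, 0) 1" and y: "y \<in> ball 1 (1 / 2) \<times> ball (0, 0) 1"
  have fst_x: "norm (fst x) \<le> 2"
    using x norm_triangle_ineq2[of "fst x" 1] by (auto simp: dist_norm norm_minus_commute)
  have snd_y: "norm (fst (snd y)) \<le> 1" "norm (snd (snd y)) \<le> 1"
    using y norm_fst_le[of "fst (snd y)" "snd (snd y)"] norm_snd_le[of "snd (snd y)" "fst (snd y)"]
    by (auto simp flip: zero_prod_def)
  have coord: "norm (fst x - fst y) \<le> dist x y" "norm (fst (snd x) - fst (snd y)) \<le> dist x y"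
    "norm (snd (snd x) - snd (snd y)) \<le> dist x y"
    by (metis dist_fst_le dist_snd_le dist_norm order_trans)+
  have "norm (?\<Phi> x - ?\<Phi> y) = norm (scl (fst x - fst y) (chart p v w (snd y)) +
      scl (fst x) (scl (fst (snd x) - fst (snd y)) v + scl (snd (snd x) - snd (snd y)) w))"
    by (intro arg_cong[of _ _ norm] pt_eqI) (simp_all add: chart_eq algebra_simps)
  also have "\<dots> \<le> dist x y * ?N + 2 * (dist x y * norm v + dist x y * norm w)"
  proof (intro norm_triangle_le add_mono)
    have "norm (chart p v w (snd y))
        \<le> norm p + norm (fst (snd y)) * norm v + norm (snd (snd y)) * norm w"
      unfolding chart_eq by (intro norm_triangle_le add_mono) (auto simp: norm_scl)
    also have "\<dots> \<le> norm p + 1 * norm v + 1 * norm w" by (intro add_mono mult_right_mono snd_y) auto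
    finally show "norm (scl (fst x - fst y) (chart p v w (snd y))) \<le> dist x y * ?N"
      unfolding norm_scl using coord(1) by (intro mult_mono) auto
    show "norm (scl (fst x) (scl (fst (snd x) - fst (snd y)) v + scl (snd (snd x) - snd (snd y)) w))
        \<le> 2 * (dist x y * norm v + dist x y * norm w)"
      unfolding norm_scl[of "fst x"]
      by (intro mult_mono fst_x norm_triangle_le add_mono)
          (auto simp: norm_scl intro!: mult_right_mono coord)
  qed
  also have "\<dots> \<le> 4 * ?N * dist x y" by (simp add: algebra_simps)
  finally show "dist (?\<Phi> x) (?\<Phi> y) \<le> 4 * ?N * dist x y" by (simp add: dist_norm)
qed simp

lemma inj_on_scl_chart:
  assumes "det3 p v w \<noteq> 0"
  shows "inj_on (\<lambda>x. scl (fst x) (chart p v w (snd x))) {x. fst x \<noteq> 0}"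
proof (rule inj_onI)
  have det: "det3 (scl (fst x) (chart p v w (snd x))) v w = fst x * det3 p v w"
    "det3 p (scl (fst x) (chart p v w (snd x))) w = fst x * fst (snd x) * det3 p v w"
    "det3 p v (scl (fst x) (chart p v w (snd x))) = fst x * snd (snd x) * det3 p v w" for x
    unfolding chart_eq det3_def pt_simps by algebra+
  fix x y assume "x \<in> {x. fst x \<noteq> (0::complex)}"
    and eq: "scl (fst x) (chart p v w (snd x)) = scl (fst y) (chart p v w (snd y))"
  then show "x = y" using det[of x] det[of y] assms unfolding eq by (auto simp: prod_eq_iff)
qed

lemma weight_integrable_at_chart:
  assumes det: "det3 p v w \<noteq> 0" and f: "continuous_on UNIV f" "homogeneous m f" and q: "q \<ge> 0"
    and loc: "weight_integrable_at q (\<lambda>st. f (chart p v w st)) (0, 0)"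
  shows "weight_integrable_at q f p"
proof -
  define \<Phi> where "\<Phi> x = scl (fst x) (chart p v w (snd x))" for x
  define g where "g st = f (chart p v w st)" for st
  have g: "continuous_on UNIV g"
    unfolding g_def by (intro continuous_on_compose2[OF f(1)] continuous_intros) auto
  have half: "1 / 2 \<le> norm \<mu>" if "\<mu> \<in> ball 1 (1 / 2)" for \<mu> :: complex
    using that norm_triangle_ineq2[of 1 "1 - \<mu>"] by (simp add: dist_norm)
  have "weight_integrable_at q f (\<Phi> (1, 0, 0))"
  proof (rule weight_integrable_at_lipschitz_image[OF q _ _
        lipschitz_on_scl_chart[of p v w, folded \<Phi>_def]])
    show "open (ball 1 (1 / 2) \<times> ball (0, 0) 1)" by (intro open_Times) auto
    have "ball 1 (1 / 2) \<times> ball (0, 0) 1 \<subseteq> {x. fst x \<noteq> (0::complex)}" using half by force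
    then show "inj_on \<Phi> (ball 1 (1 / 2) \<times> ball (0, 0) 1)"
      unfolding \<Phi>_def by (rule inj_on_subset[OF inj_on_scl_chart[OF det]])
    show "weight_integrable_at q (\<lambda>x. g (snd x)) (1, 0, 0)"
      using loc
      by (intro weight_integrable_at_snd)
          (auto simp: g_def[abs_def, symmetric] g borel_measurable_continuous_onI)
    show "(\<lambda>x. g (snd x)) \<in> borel_measurable borel"
      by (intro borel_measurable_continuous_onI continuous_on_compose2[OF g] continuous_intros) auto
    fix x :: "complex \<times> complex \<times> complex" assume "x \<in> ball 1 (1 / 2) \<times> ball (0, 0) 1"
    then have "(1 / 2) ^ m \<le> norm (fst x) ^ m" using half by (intro power_mono) auto
    then show "(1 / 2) ^ m * norm (g (snd x)) \<le> norm (f (\<Phi> x))"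
      by (simp add: \<Phi>_def homogeneousD[OF f(2)] g_def norm_mult norm_power mult_right_mono)
  qed (use f(1) in \<open>auto simp: zero_prod_def intro: borel_measurable_continuous_onI\<close>)
  then show ?thesis by (simp add: \<Phi>_def chart_eq)
qed

lemma weight_integrable_at_sing_type:
  assumes f: "continuous_on UNIV f" "homogeneous m f" and g: "continuous_on UNIV g"
    and q: "q \<ge> 0" and loc: "weight_integrable_at q g (0, 0)" and sing: "sing_type f p g"
  shows "weight_integrable_at q f p"
proof -
  obtain v w where vw: "det3 p v w \<noteq> 0" "contact_equiv (\<lambda>st. f (chart p v w st)) g"
    using sing by (auto simp: sing_type_def)
  have "continuous_on UNIV (\<lambda>st. f (chart p v w st))"
    by (intro continuous_on_compose2[OF f(1)] continuous_intros) auto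
  then have "weight_integrable_at q (\<lambda>st. f (chart p v w st)) (0, 0)"
    using g by (intro weight_integrable_at_contact_equiv[OF vw(2) _ _ q loc]
        borel_measurable_continuous_onI)
  then show ?thesis by (rule weight_integrable_at_chart[OF vw(1) f q])
qed

lemma norm_diff_ge_if_derivative_near:
  fixes h :: "complex \<Rightarrow> complex"
  assumes S: "convex S" "x \<in> S" "y \<in> S"
    and h: "\<And>z. z \<in> S \<Longrightarrow> (h has_field_derivative h' z) (at z)" "\<And>z. z \<in> S \<Longrightarrow> norm (h' z - d) \<le> B"
  shows "(norm d - B) * norm (x - y) \<le> norm (h x - h y)"
proof -
  have "norm ((h x - d * x) - (h y - d * y)) \<le> B * norm (x - y)"
  proof (rule field_differentiable_bound[OF S(1) _ h(2) S(2,3)])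
    fix z assume "z \<in> S"
    from DERIV_diff[OF h(1)[OF this] DERIV_cmult_Id]
    show "((\<lambda>z. h z - d * z) has_field_derivative h' z - d) (at z within S)"
      by (rule has_field_derivative_at_within)
  qed
  moreover have "norm d * norm (x - y) \<le> norm (h x - h y) + norm ((h x - d * x) - (h y - d * y))"
    using norm_triangle_ineq4[of "h x - h y" "(h x - d * x) - (h y - d * y)"]
    by (simp add: norm_mult[symmetric] right_diff_distrib)
  ultimately show ?thesis unfolding left_diff_distrib by linarith
qed

lemma weight_integrable_at_grad_nonzero:
  assumes f: "holo3 f" and p: "grad f p \<noteq> 0" and q: "0 \<le> q" "q < 2"
  shows "weight_integrable_at q f p"
proof -
  define v where "v = cnj3 (grad f p)"
  define d where "d = grad f p \<odot> v"
  have d: "norm d / 2 > 0" using p by (simp add: d_def v_def dot3_cnj3_self)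
  have "continuous (at p) (\<lambda>x. grad f x \<odot> v)"
    using continuous_on_dot3[OF holo3_continuous_on_grad[OF f] continuous_on_const, of UNIV v]
    by (metis UNIV_I continuous_on_eq_continuous_at open_UNIV)
  then obtain R where R: "R > 0" "\<And>x. dist x p < R \<Longrightarrow> norm (grad f x \<odot> v - d) < norm d / 2"
    using d unfolding continuous_at_eps_delta dist_norm d_def by metis
  define r where "r = R / (1 + norm v)"
  have r: "r > 0" "r + r * norm v = R"
    using R(1) by (simp_all add: r_def add_pos_nonneg field_simps add_nonneg_eq_0_iff)
  have "norm d / 2 * norm (s - s') \<le> norm (f (x + scl s v) - f (x + scl s' v))"
    if x: "x \<in> ball p r" and s: "s \<in> cball 0 r" "s' \<in> cball 0 r" for x s s'
  proof -
    have deriv: "((\<lambda>t. f (x + scl t v)) has_field_derivative grad f (x + scl t v) \<odot> v) (at t)" for t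
    proof -
      have "((\<lambda>t. x + scl t v) has_derivative (\<lambda>k. scl k v)) (at t)"
        using has_derivative_add[OF has_derivative_const
            bounded_linear_imp_has_derivative[OF bounded_linear_scl_left]]
        by simp
      from has_derivative_compose[OF this holo3_has_derivative[OF f]] show ?thesis
        unfolding has_field_derivative_def by (rule has_derivative_eq_rhs) auto
    qed
    have near: "norm (grad f (x + scl t v) \<odot> v - d) \<le> norm d / 2" if t: "t \<in> cball 0 r" for t
    proof -
      have "norm (scl t v) \<le> r * norm v" unfolding norm_scl using t by (intro mult_right_mono) auto
      then have "dist (x + scl t v) p < R"
        using x r(2) norm_triangle_ineq[of "x - p" "scl t v"]
        by (simp add: dist_norm norm_minus_commute algebra_simps)
      then show ?thesis using R(2) by (simp add: less_imp_le)
    qed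
    show ?thesis
      using norm_diff_ge_if_derivative_near[OF convex_cball s deriv near] by simp
  qed
  then show ?thesis
    using weight_integrable_at_expanding_direction[OF q holo3_continuous_on[OF f]
        bounded_linear_scl_left d r(1)] by blast
qed

lemma weight_integrable_at_nonorigin:
  assumes f: "holo3 f" "homogeneous m f" and s: "0 \<le> s" "s < 2 / 3"
    and sing: "\<And>p. sing_point f p \<Longrightarrow> sing_type f p nf_A1 \<or> sing_type f p nf_A5 \<or> sing_type f p nf_D4"
    and p: "p \<noteq> 0"
  shows "weight_integrable_at (2 * s) f p"
proof -
  consider "f p \<noteq> 0" | "grad f p \<noteq> 0" | "sing_point f p"
    using p by (auto simp: sing_point_def grad_def zero_prod_def)
  then show ?thesis
  proof cases
    case 1
    then show ?thesis using s by (intro weight_integrable_at_nonzero holo3_continuous_on f) auto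
  next
    case 2
    then show ?thesis using s by (intro weight_integrable_at_grad_nonzero f) auto
  next
    case 3
    then obtain g where "sing_type f p g" "continuous_on UNIV g"
        "weight_integrable_at (2 * s) g (0, 0)"
      using sing continuous_on_nf weight_integrable_at_nf_A1[OF s] weight_integrable_at_nf_A5[OF s]
        weight_integrable_at_nf_D4[OF s] by blast
    then show ?thesis
      using s weight_integrable_at_sing_type[OF holo3_continuous_on[OF f(1)] f(2)] by simp
  qed
qed

subsection \<open>Integration by parts\<close>

lemma integrable_continuous_bounded_support:
  fixes F :: "'a::euclidean_space \<Rightarrow> 'b::{banach, second_countable_topology}"
  assumes F: "continuous_on UNIV F" and supp: "\<And>v. norm v \<ge> R \<Longrightarrow> F v = 0"
  shows "integrable lborel F"
proof -
  have "integrable lborel (\<lambda>v. indicator (cball 0 R) v *\<^sub>R F v)"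
    by (rule borel_integrable_compact) (auto intro: continuous_on_subset[OF F])
  also have "(\<lambda>v. indicator (cball 0 R) v *\<^sub>R F v) = F"
    by (rule ext) (auto simp: indicator_def supp)
  finally show ?thesis .
qed

lemma lborel_integral_translate:
  fixes F :: "'a::euclidean_space \<Rightarrow> 'b::{banach, second_countable_topology}"
  assumes "F \<in> borel_measurable borel"
  shows "(\<integral>v. F (v + c) \<partial>lborel) = (\<integral>v. F v \<partial>lborel)"
  using integral_distr[of "(+) c" lborel borel F] assms by (simp add: lborel_distr_plus add.commute)

lemma has_derivative_eq_0_if_locally_0:
  assumes "(F has_derivative D) (at v)" "open S" "v \<in> S" "\<And>x. x \<in> S \<Longrightarrow> F x = 0"
  shows "D = (\<lambda>_. 0)"
proof (rule has_derivative_unique[OF assms(1)])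
  show "(F has_derivative (\<lambda>_. 0)) (at v)"
    by (rule has_derivative_transform_within_open[OF has_derivative_const assms(2,3)])
        (simp add: assms(4))
qed

lemma lborel_integral_line_average:
  fixes G :: "'a::euclidean_space \<Rightarrow> 'b::euclidean_space"
  assumes G: "continuous_on UNIV G" and supp: "\<And>v. norm v \<ge> R \<Longrightarrow> G v = 0"
  shows "(\<integral>v. (\<integral>t. indicator {0..1::real} t *\<^sub>R G (v + t *\<^sub>R e) \<partial>lborel) \<partial>lborel) = (\<integral>v. G v \<partial>lborel)"
proof -
  define H where "H t v = indicator {0..1::real} t *\<^sub>R G (v + t *\<^sub>R e)" for t v
  let ?K = "{0..1} \<times> cball 0 (R + norm e)"
  have "integrable lborel (\<lambda>x. indicator ?K x *\<^sub>R G (snd x + fst x *\<^sub>R e))"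
    by (intro borel_integrable_compact compact_Times continuous_on_compose2[OF G] continuous_intros)
       auto
  also have "(\<lambda>x. indicator ?K x *\<^sub>R G (snd x + fst x *\<^sub>R e)) = case_prod H"
  proof (intro ext, clarify)
    fix t :: real and v
    have "G (v + t *\<^sub>R e) = 0" if t: "t \<in> {0..1}" and v: "\<not> norm v \<le> R + norm e"
    proof (rule supp)
      have "\<bar>t\<bar> * norm e \<le> 1 * norm e" using t by (intro mult_right_mono) auto
      then show "R \<le> norm (v + t *\<^sub>R e)" using v norm_triangle_ineq2[of v "- (t *\<^sub>R e)"] by simp
    qed
    then show "indicator ?K (t, v) *\<^sub>R G (snd (t, v) + fst (t, v) *\<^sub>R e) = H t v"
      by (auto simp: H_def indicator_def)
  qed
  finally have "integrable (lborel \<Otimes>\<^sub>M lborel) (case_prod H)" by (simp add: lborel_prod)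
  then have "(\<integral>v. (\<integral>t. H t v \<partial>lborel) \<partial>lborel) = (\<integral>t. (\<integral>v. H t v \<partial>lborel) \<partial>lborel)"
    by (rule lborel_pair.Fubini_integral)
  also have "\<dots> = (\<integral>v. G v \<partial>lborel)"
    using G by (simp add: H_def lborel_integral_translate borel_measurable_continuous_onI)
  finally show ?thesis by (simp add: H_def)
qed

lemma lborel_integral_derivative_along_segment:
  fixes F :: "'a::real_normed_vector \<Rightarrow> 'b::euclidean_space"
  assumes D: "\<And>v. (F has_derivative D v) (at v)" and cont: "continuous_on UNIV (\<lambda>v. D v e)"
  shows "(\<integral>t. indicator {0..1::real} t *\<^sub>R D (v + t *\<^sub>R e) e \<partial>lborel) = F (v + e) - F v"
proof -
  have "((\<lambda>t. F (v + t *\<^sub>R e)) has_vector_derivative D (v + t *\<^sub>R e) e) (at t within {0..1})" for t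
  proof -
    have "((\<lambda>t. v + t *\<^sub>R e) has_derivative (\<lambda>h. h *\<^sub>R e)) (at t within {0..1})"
      by (auto intro!: derivative_eq_intros)
    from has_derivative_compose[OF this D] show ?thesis
      unfolding has_vector_derivative_def
      by (rule has_derivative_eq_rhs) (simp add: linear_scale[OF has_derivative_linear[OF D]])
  qed
  then have "(\<integral>t. indicator {0..1} t *\<^sub>R D (v + t *\<^sub>R e) e \<partial>lborel) = F (v + 1 *\<^sub>R e) - F (v + 0 *\<^sub>R e)"
    by (intro integral_FTC_atLeastAtMost continuous_on_compose2[OF cont] continuous_intros) auto
  then show ?thesis by simp
qed

lemma lborel_integral_directional_derivative_eq_0:
  fixes F :: "'a::euclidean_space \<Rightarrow> 'b::euclidean_space"
  assumes D: "\<And>v. (F has_derivative D v) (at v)" and cont: "continuous_on UNIV (\<lambda>v. D v e)"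
    and supp: "\<And>v. norm v \<ge> R \<Longrightarrow> F v = 0"
  shows "integrable lborel (\<lambda>v. D v e)" "(\<integral>v. D v e \<partial>lborel) = 0"
proof -
  have F: "continuous_on UNIV F"
    by (intro continuous_at_imp_continuous_on ballI has_derivative_continuous[OF D])
  have outside: "open {v::'a. R < norm v}" by (intro open_Collect_less continuous_intros)
  have D_eq_0: "D v e = 0" if "norm v \<ge> R + 1" for v
  proof -
    have "D v = (\<lambda>_. 0)"
      by (rule has_derivative_eq_0_if_locally_0[OF D outside]) (use supp that in auto)
    then show ?thesis by simp
  qed
  show "integrable lborel (\<lambda>v. D v e)"
    by (rule integrable_continuous_bounded_support[OF cont D_eq_0])
  have "(\<integral>v. D v e \<partial>lborel) = (\<integral>v. F (v + e) - F v \<partial>lborel)"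
    using lborel_integral_line_average[OF cont D_eq_0, where e = e]
    by (simp add: lborel_integral_derivative_along_segment[OF D cont])
  also have "\<dots> = 0"
  proof -
    have "integrable lborel F" by (rule integrable_continuous_bounded_support[OF F supp])
    moreover have "integrable lborel (\<lambda>v. F (v + e))"
    proof (rule integrable_continuous_bounded_support)
      show "F (v + e) = 0" if "norm v \<ge> R + norm e" for v
        using that norm_triangle_ineq2[of v "- e"] by (intro supp) simp
    qed (auto intro!: continuous_on_compose2[OF F] continuous_intros)
    ultimately show ?thesis
      using lborel_integral_translate[of F e] F by (simp add: borel_measurable_continuous_onI)
  qed
  finally show "(\<integral>v. D v e \<partial>lborel) = 0" .
qed

text \<open>The complex-linear part of a real-linear form, that is, its Wirtinger derivative \<open>\<partial>\<close>.\<close>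

definition holo_part :: "(pt \<Rightarrow> complex) \<Rightarrow> pt \<Rightarrow> complex" where
  "holo_part T w = (T w - \<i> * T (scl \<i> w)) / 2"

lemma holo_part_add: "holo_part (\<lambda>w. S w + T w) w = holo_part S w + holo_part T w"
  by (simp add: holo_part_def algebra_simps add_divide_distrib diff_divide_distrib)

lemma holo_part_mult_left: "holo_part (\<lambda>w. a * T w) w = a * holo_part T w"
  by (simp add: holo_part_def algebra_simps)

lemma holo_part_dot3: "holo_part ((\<odot>) u) w = u \<odot> w"
  by (simp add: holo_part_def)

lemma holo_part_cnj_dot3: "holo_part (\<lambda>w. cnj (u \<odot> w)) w = 0"
  by (simp add: holo_part_def)

lemma holo_part_Re_dot3: "holo_part (\<lambda>w. of_real (Re (u \<odot> w))) w = (u \<odot> w) / 2"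
  by (simp add: holo_part_def complex_eq_iff)

lemma holo_part_eq_sum_coordinates:
  assumes "linear T"
  shows "holo_part T w
    = px w * holo_part T (1, 0, 0) + py w * holo_part T (0, 1, 0) + pz w * holo_part T (0, 0, 1)"
proof -
  have scl: "holo_part T (scl \<mu> e) = \<mu> * holo_part T e" for \<mu> e
  proof -
    obtain a b where \<mu>: "\<mu> = of_real a + \<i> * of_real b" using complex_eq by blast
    have "scl \<mu> e = a *\<^sub>R e + b *\<^sub>R scl \<i> e" "scl (\<i> * \<mu>) e = a *\<^sub>R scl \<i> e - b *\<^sub>R e"
      unfolding scl_of_real[symmetric] by (auto intro!: pt_eqI simp: \<mu> algebra_simps)
    then have "T (scl \<mu> e) = of_real a * T e + of_real b * T (scl \<i> e)"
      "T (scl (\<i> * \<mu>) e) = of_real a * T (scl \<i> e) - of_real b * T e"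
      using assms by (simp_all add: linear_add linear_diff linear_scale scaleR_conv_of_real)
    then show ?thesis by (simp add: holo_part_def) (simp add: \<mu> field_simps)
  qed
  have add: "holo_part T (u + v) = holo_part T u + holo_part T v" for u v
  proof -
    have "scl \<i> (u + v) = scl \<i> u + scl \<i> v" by (auto intro: pt_eqI simp: algebra_simps)
    then show ?thesis
      using assms
      by (simp add: holo_part_def linear_add algebra_simps add_divide_distrib diff_divide_distrib)
  qed
  have "w = scl (px w) (1, 0, 0) + scl (py w) (0, 1, 0) + scl (pz w) (0, 0, 1)"
    by (rule pt_eqI) simp_all
  then show ?thesis by (metis scl add)
qed

lemma integral_divergence_eq_0:
  assumes \<delta>: "coordinatewise holo3 \<delta>" and u: "\<And>v. (u has_derivative Du v) (at v)"
    and cont: "\<And>e. continuous_on UNIV (\<lambda>v. Du v e)" and supp: "\<And>v. norm v \<ge> R \<Longrightarrow> u v = 0"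
  shows "(\<integral>v. divergence \<delta> v * u v + holo_part (Du v) (\<delta> v) \<partial>lborel) = 0"
proof -
  have cont_u: "continuous_on UNIV u"
    by (intro continuous_at_imp_continuous_on ballI has_derivative_continuous[OF u])
  have part: "integrable lborel (\<lambda>v. (grad k v \<odot> e) * u v + k v * holo_part (Du v) e)"
    "(\<integral>v. (grad k v \<odot> e) * u v + k v * holo_part (Du v) e \<partial>lborel) = 0" if k: "holo3 k" for k e
  proof -
    define T where "T v w = u v * (grad k v \<odot> w) + k v * Du v w" for v w
    have T: "((\<lambda>v. k v * u v) has_derivative T v) (at v)" for v
      using has_derivative_mult[OF holo3_has_derivative[OF k] u[of v]]
      by (rule has_derivative_eq_rhs) (auto simp: T_def)
    have cont_T: "continuous_on UNIV (\<lambda>v. T v w)" for w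
      unfolding T_def
      by (intro continuous_intros cont cont_u holo3_continuous_on holo3_continuous_on_grad k)
    have "holo_part (T v) e = (grad k v \<odot> e) * u v + k v * holo_part (Du v) e" for v
      unfolding T_def[abs_def] by (simp add: holo_part_add holo_part_mult_left holo_part_dot3)
    moreover have "integrable lborel (\<lambda>v. T v w)" "(\<integral>v. T v w \<partial>lborel) = 0" for w
      using lborel_integral_directional_derivative_eq_0[OF T cont_T, of R w] supp by auto
    then have "integrable lborel (\<lambda>v. holo_part (T v) e)" "(\<integral>v. holo_part (T v) e \<partial>lborel) = 0"
      by (simp_all add: holo_part_def)
    ultimately show "integrable lborel (\<lambda>v. (grad k v \<odot> e) * u v + k v * holo_part (Du v) e)"
      "(\<integral>v. (grad k v \<odot> e) * u v + k v * holo_part (Du v) e \<partial>lborel) = 0"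
      by simp_all
  qed
  have "divergence \<delta> v * u v + holo_part (Du v) (\<delta> v) =
      ((grad (\<lambda>v. px (\<delta> v)) v \<odot> (1, 0, 0)) * u v + px (\<delta> v) * holo_part (Du v) (1, 0, 0)) +
      ((grad (\<lambda>v. py (\<delta> v)) v \<odot> (0, 1, 0)) * u v + py (\<delta> v) * holo_part (Du v) (0, 1, 0)) +
      ((grad (\<lambda>v. pz (\<delta> v)) v \<odot> (0, 0, 1)) * u v + pz (\<delta> v) * holo_part (Du v) (0, 0, 1))" for v
    using holo_part_eq_sum_coordinates[OF has_derivative_linear[OF u], of v "\<delta> v"]
    by (simp add: divergence_eq_grad dot3_def algebra_simps)
  then show ?thesis using \<delta> part by (simp add: coordinatewise_def)
qed

lemma integral_divergence_real_density_eq_0: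
  assumes \<delta>: "coordinatewise holo3 \<delta>" and g: "holo3 g"
    and \<rho>: "\<And>v. (\<rho> has_derivative (\<lambda>w. 2 * Re (A v \<odot> w))) (at v)" "continuous_on UNIV A"
    and supp: "\<And>v. norm v \<ge> R \<Longrightarrow> \<rho> v = 0"
  shows "(\<integral>v. cnj (g v) * (divergence \<delta> v * of_real (\<rho> v) + A v \<odot> \<delta> v) \<partial>lborel) = 0"
proof -
  define u where "u v = cnj (g v) * of_real (\<rho> v)" for v
  define Du where "Du v w
      = of_real (\<rho> v) * cnj (grad g v \<odot> w) + 2 * cnj (g v) * of_real (Re (A v \<odot> w))"
    for v w
  have "((\<lambda>v. cnj (g v)) has_derivative (\<lambda>w. cnj (grad g v \<odot> w))) (at v)" for v
    by (rule bounded_linear.has_derivative[OF bounded_linear_cnj holo3_has_derivative[OF g]])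
  from has_derivative_mult[OF this has_derivative_of_real[OF \<rho>(1)]]
  have u: "(u has_derivative Du v) (at v)" for v
    unfolding u_def[abs_def]
    by (rule has_derivative_eq_rhs) (auto simp: fun_eq_iff Du_def algebra_simps)
  have "continuous_on UNIV \<rho>"
    by (intro continuous_at_imp_continuous_on ballI has_derivative_continuous[OF \<rho>(1)])
  then have "continuous_on UNIV (\<lambda>v. Du v e)" for e
    unfolding Du_def using g \<rho>(2)
    by (intro continuous_intros holo3_continuous_on holo3_continuous_on_grad)
  then have "(\<integral>v. divergence \<delta> v * u v + holo_part (Du v) (\<delta> v) \<partial>lborel) = 0"
    by (rule integral_divergence_eq_0[OF \<delta> u, of R]) (simp add: u_def supp)
  moreover have "holo_part (Du v) (\<delta> v) = cnj (g v) * (A v \<odot> \<delta> v)" for v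
    unfolding Du_def[abs_def] holo_part_add holo_part_mult_left holo_part_cnj_dot3 holo_part_Re_dot3
    by simp
  ultimately show ?thesis by (simp add: u_def algebra_simps)
qed

lemma has_derivative_norm_squared_holo3:
  assumes "holo3 f"
  shows "((\<lambda>v. (norm (f v))\<^sup>2) has_derivative (\<lambda>w. 2 * Re (scl (cnj (f v)) (grad f v) \<odot> w))) (at v)"
  unfolding power2_norm_eq_inner
  by (rule has_derivative_eq_rhs[OF has_derivative_inner[OF
          holo3_has_derivative holo3_has_derivative]])
     (use assms in \<open>auto simp: fun_eq_iff inner_complex_def algebra_simps\<close>)

lemma has_derivative_norm_squared_pt:
  fixes v :: pt
  shows "((\<lambda>v. (norm v)\<^sup>2) has_derivative (\<lambda>w. 2 * Re (cnj3 v \<odot> w))) (at v)"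
proof -
  have "((\<lambda>v. v \<bullet> v) has_derivative (\<lambda>w. 2 * (w \<bullet> v))) (at v)"
    by (auto intro!: derivative_eq_intros simp: inner_commute)
  then show ?thesis by (simp add: power2_norm_eq_inner inner_eq_Re_dot3[where w = v] dot3_commute)
qed

text \<open>A weight that is a function of \<open>|f|\<close> is annihilated by \<open>\<delta>\<close>, so only the cutoff is
  differentiated.\<close>

lemma integral_divergence_smooth_weight_eq_0:
  assumes hol: "coordinatewise holo3 \<delta>" "holo3 f" "holo3 g" and syz: "\<And>v. grad f v \<odot> \<delta> v = 0"
    and P: "\<And>t. t \<ge> 0 \<Longrightarrow> (P has_real_derivative P' t) (at t)" "continuous_on {0..} P'"
    and \<phi>: "\<And>t. (\<phi> has_real_derivative \<phi>' t) (at t)" "continuous_on UNIV \<phi>'"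
      "\<And>t. t \<ge> 4 \<Longrightarrow> \<phi> t = 0"
  shows "(\<integral>v. of_real (P ((norm (f v))\<^sup>2)) * (cnj (g v) * (divergence \<delta> v * of_real (\<phi> ((norm v)\<^sup>2)) +
    (\<delta> v \<odot> cnj3 v) * of_real (\<phi>' ((norm v)\<^sup>2)))) \<partial>lborel) = 0"
proof -
  define Pf where "Pf v = P ((norm (f v))\<^sup>2)" for v
  define Pf' where "Pf' v = P' ((norm (f v))\<^sup>2)" for v
  define ph where "ph v = \<phi> ((norm v)\<^sup>2)" for v :: pt
  define ph' where "ph' v = \<phi>' ((norm v)\<^sup>2)" for v :: pt
  define A where "A v
      = scl (of_real (Pf' v * ph v) * cnj (f v)) (grad f v) + scl (of_real (Pf v * ph' v)) (cnj3 v)"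
    for v
  have dPf: "(Pf has_derivative (\<lambda>w. Pf' v * (2 * Re (scl (cnj (f v)) (grad f v) \<odot> w)))) (at v)"
    for v
    using has_derivative_compose[OF has_derivative_norm_squared_holo3[OF hol(2)]
        P(1)[OF zero_le_power2, unfolded has_field_derivative_def]]
    by (simp add: Pf_def[abs_def] Pf'_def)
  have dph: "(ph has_derivative (\<lambda>w. ph' v * (2 * Re (cnj3 v \<odot> w)))) (at v)" for v
    using has_derivative_compose[OF has_derivative_norm_squared_pt
        \<phi>(1)[unfolded has_field_derivative_def]]
    by (simp add: ph_def[abs_def] ph'_def)
  have deriv: "((\<lambda>v. Pf v * ph v) has_derivative (\<lambda>w. 2 * Re (A v \<odot> w))) (at v)" for v
    using has_derivative_mult[OF dPf dph]
    by (rule has_derivative_eq_rhs) (auto simp: fun_eq_iff A_def algebra_simps)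
  have "continuous_on UNIV Pf" "continuous_on UNIV ph"
    by (intro continuous_at_imp_continuous_on ballI has_derivative_continuous[OF dPf]
        has_derivative_continuous[OF dph])+
  moreover have "continuous_on UNIV Pf'"
    unfolding Pf'_def
    by (intro continuous_on_compose2[OF P(2)] continuous_intros holo3_continuous_on[OF hol(2)]) auto
  moreover have "continuous_on UNIV ph'"
    unfolding ph'_def by (intro continuous_on_compose2[OF \<phi>(2)] continuous_intros) auto
  ultimately have "continuous_on UNIV A"
    unfolding A_def using hol
    by (intro continuous_intros holo3_continuous_on holo3_continuous_on_grad)
  moreover have "Pf v * ph v = 0" if "norm v \<ge> 2" for v
    using \<phi>(3)[of "(norm v)\<^sup>2"] power_mono[OF that, of 2] by (simp add: ph_def)
  ultimately have "(\<integral>v. cnj (g v) *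
      (divergence \<delta> v * of_real (Pf v * ph v) + A v \<odot> \<delta> v) \<partial>lborel) = 0"
    using integral_divergence_real_density_eq_0[OF hol(1,3) deriv] by blast
  then show ?thesis
    by (simp add: A_def syz dot3_commute[of _ "cnj3 _"] Pf_def ph_def ph'_def algebra_simps)
qed

definition shell :: "pt set" where
  "shell = {v. 1 / 4 \<le> (norm v)\<^sup>2 \<and> (norm v)\<^sup>2 \<le> 4}"

lemma shell_nonzero: "v \<in> shell \<Longrightarrow> v \<noteq> 0"
  by (auto simp: shell_def)

lemma compact_shell: "compact shell"
proof (subst compact_eq_bounded_closed, intro conjI)
  have "norm v \<le> 2" if "v \<in> shell" for v
    by (rule power2_le_imp_le) (use that in \<open>simp_all add: shell_def\<close>)
  then show "bounded shell" unfolding bounded_iff by blast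
  show "closed shell"
    unfolding shell_def by (intro closed_Collect_conj closed_Collect_le continuous_intros)
qed

lemma sets_borel_shell [measurable]: "shell \<in> sets borel"
  using compact_shell by (rule borel_compact)

lemma set_integrable_weight:
  fixes f X :: "'a::euclidean_space \<Rightarrow> complex"
  assumes K: "compact K" and f: "continuous_on UNIV f" and X: "continuous_on K X"
    and fin: "(\<integral>\<^sup>+x\<in>K. weight (2 * s) (f x) \<partial>lborel) < \<infinity>"
  shows "set_integrable lborel K (\<lambda>v. of_real (norm (f v) powr (- 2 * s)) * X v)"
proof -
  have [measurable]: "K \<in> sets borel" using K by (rule borel_compact)
  have [measurable]: "f \<in> borel_measurable borel" using f by (rule borel_measurable_continuous_onI)
  have X' [measurable]: "(\<lambda>v. indicator K v *\<^sub>R X v) \<in> borel_measurable borel"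
    by (rule borel_measurable_continuous_on_indicator) (use X in auto)
  obtain M where M: "\<And>v. v \<in> K \<Longrightarrow> norm (X v) \<le> M"
    using compact_imp_bounded[OF compact_continuous_image[OF X K]] by (auto simp: bounded_iff)
  have "integrable lborel (\<lambda>v. norm (f v) powr (- 2 * s) * indicator K v)"
  proof (rule integrableI_bounded)
    have "(\<integral>\<^sup>+v. norm (norm (f v) powr (- 2 * s) * indicator K v) \<partial>lborel)
        \<le> (\<integral>\<^sup>+x\<in>K. weight (2 * s) (f x) \<partial>lborel)"
      by (rule nn_integral_mono) (auto simp: weight_def indicator_def)
    then show "(\<integral>\<^sup>+v. norm (norm (f v) powr (- 2 * s) * indicator K v) \<partial>lborel) < \<infinity>"
      using fin by (rule le_less_trans)
  qed measurable
  then have "integrable lborel (\<lambda>v. norm (f v) powr (- 2 * s) * indicator K v * M)" by simp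
  then have "integrable lborel (\<lambda>v. of_real (norm (f v) powr (- 2 * s)) * (indicator K v *\<^sub>R X v))"
  proof (rule Bochner_Integration.integrable_bound)
    show "AE v in lborel. norm (of_real (norm (f v) powr (- 2 * s)) * (indicator K v *\<^sub>R X v))
        \<le> norm (norm (f v) powr (- 2 * s) * indicator K v * M)"
    proof (rule AE_I2)
      fix v
      show "norm (of_real (norm (f v) powr (- 2 * s)) * (indicator K v *\<^sub>R X v))
        \<le> norm (norm (f v) powr (- 2 * s) * indicator K v * M)"
        using M[of v]
        by (cases "v \<in> K") (auto simp: norm_mult intro: order_trans[OF mult_left_mono abs_ge_self])
    qed
  qed measurable
  then show ?thesis by (simp add: set_integrable_def)
qed

lemma integrable_weight_if_support:
  fixes f X :: "'a::euclidean_space \<Rightarrow> complex"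
  assumes K: "compact K" and f: "continuous_on UNIV f" and X: "continuous_on UNIV X"
    and supp: "\<And>v. v \<notin> K \<Longrightarrow> X v = 0" and fin: "(\<integral>\<^sup>+x\<in>K. weight (2 * s) (f x) \<partial>lborel) < \<infinity>"
  shows "integrable lborel (\<lambda>v. of_real (norm (f v) powr (- 2 * s)) * X v)"
proof -
  have "set_integrable lborel K (\<lambda>v. of_real (norm (f v) powr (- 2 * s)) * X v)"
    by (rule set_integrable_weight[OF K f continuous_on_subset[OF X] fin]) simp
  moreover have "(\<lambda>v. indicator K v *\<^sub>R (of_real (norm (f v) powr (- 2 * s)) * X v))
      = (\<lambda>v. of_real (norm (f v) powr (- 2 * s)) * X v)"
    using supp by (auto simp: fun_eq_iff indicator_def)
  ultimately show ?thesis by (simp add: set_integrable_def)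
qed

lemma AE_nonzero_if_weight_finite:
  assumes [measurable]: "f \<in> borel_measurable borel" "K \<in> sets borel"
    and fin: "(\<integral>\<^sup>+x\<in>K. weight q (f x) \<partial>lborel) < \<infinity>"
  shows "AE v in lborel. v \<in> K \<longrightarrow> f v \<noteq> 0"
proof -
  have "AE v in lborel. weight q (f v) * indicator K v \<noteq> \<infinity>"
    by (rule nn_integral_PInf_AE) (use fin in auto)
  then show ?thesis by eventually_elim (auto simp: weight_def)
qed

lemma integral_regularized_weight_tendsto:
  fixes f X :: "'a::euclidean_space \<Rightarrow> complex"
  assumes [measurable]: "f \<in> borel_measurable borel" "X \<in> borel_measurable borel" and s: "s \<ge> 0"
    and int: "integrable lborel (\<lambda>v. of_real (norm (f v) powr (- 2 * s)) * X v)"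
    and ae: "AE v in lborel. X v \<noteq> 0 \<longrightarrow> f v \<noteq> 0"
  shows "(\<lambda>n. \<integral>v. of_real (((norm (f v))\<^sup>2 + 1 / real (Suc n)) powr (- s)) * X v \<partial>lborel)
    \<longlonglongrightarrow> (\<integral>v. of_real (norm (f v) powr (- 2 * s)) * X v \<partial>lborel)"
proof (rule integral_dominated_convergence
    [where w = "\<lambda>v. norm (of_real (norm (f v) powr (- 2 * s)) * X v)"])
  have powr_norm_eq: "norm (f v) powr (- 2 * s) = ((norm (f v))\<^sup>2) powr (- s)" if "f v \<noteq> 0" for v
    using that powr_powr[of "norm (f v)" 2 "- s"] by (simp add: powr_numeral)
  show "AE v in lborel. (\<lambda>n. of_real (((norm (f v))\<^sup>2 + 1 / real (Suc n)) powr (- s)) * X v)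
      \<longlonglongrightarrow> of_real (norm (f v) powr (- 2 * s)) * X v"
    using ae
  proof eventually_elim
    case (elim v)
    show ?case
    proof (cases "X v = 0")
      case False
      then have f_nonzero: "f v \<noteq> 0" using elim by blast
      have "(\<lambda>n. ((norm (f v))\<^sup>2 + 1 / real (Suc n)) powr (- s)) \<longlonglongrightarrow> ((norm (f v))\<^sup>2 + 0) powr (- s)"
        using f_nonzero by (intro tendsto_intros LIMSEQ_Suc[OF lim_1_over_n]) auto
      then show ?thesis
        unfolding powr_norm_eq[OF f_nonzero] by (intro tendsto_mult_right tendsto_of_real) simp
    qed simp
  qed
  show "AE v in lborel. norm (of_real (((norm (f v))\<^sup>2 + 1 / real (Suc n)) powr (- s)) * X v)
      \<le> norm (of_real (norm (f v) powr (- 2 * s)) * X v)" for n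
    using ae
  proof eventually_elim
    case (elim v)
    show ?case
    proof (cases "X v = 0")
      case False
      then have f_nonzero: "f v \<noteq> 0" using elim by blast
      then have "((norm (f v))\<^sup>2 + 1 / real (Suc n)) powr (- s) \<le> norm (f v) powr (- 2 * s)"
        unfolding powr_norm_eq[OF f_nonzero] using s by (intro powr_mono2') auto
      then show ?thesis by (simp add: norm_mult mult_right_mono)
    qed simp
  qed
qed (use int in auto)

lemma continuous_on_divergence: "coordinatewise holo3 \<delta> \<Longrightarrow> continuous_on S (divergence \<delta>)"
  unfolding divergence_eq_grad[abs_def] coordinatewise_def
  by (intro continuous_intros holo3_continuous_on_grad) auto

lemma integral_divergence_weight_eq_0:
  assumes hol: "coordinatewise holo3 \<delta>" "holo3 f" "holo3 g" and syz: "\<And>v. grad f v \<odot> \<delta> v = 0"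
    and \<phi>: "\<And>t. (\<phi> has_real_derivative \<phi>' t) (at t)" "continuous_on UNIV \<phi>'"
      "\<And>t. t \<ge> 4 \<or> t \<le> 1 / 4 \<Longrightarrow> \<phi> t = 0 \<and> \<phi>' t = 0"
    and s: "s \<ge> 0" and fin: "(\<integral>\<^sup>+x\<in>shell. weight (2 * s) (f x) \<partial>lborel) < \<infinity>"
  shows "(\<integral>v. of_real (norm (f v) powr (- 2 * s)) *
    (cnj (g v) * (divergence \<delta> v * of_real (\<phi> ((norm v)\<^sup>2)) +
      (\<delta> v \<odot> cnj3 v) * of_real (\<phi>' ((norm v)\<^sup>2)))) \<partial>lborel) = 0"
proof -
  define X where "X v = cnj (g v) * (divergence \<delta> v * of_real (\<phi> ((norm v)\<^sup>2)) +
    (\<delta> v \<odot> cnj3 v) * of_real (\<phi>' ((norm v)\<^sup>2)))" for v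
  note cont_f = holo3_continuous_on[OF hol(2)]
  have "continuous_on UNIV \<phi>" by (intro continuous_at_imp_continuous_on ballI DERIV_isCont[OF \<phi>(1)])
  then have "continuous_on UNIV (\<lambda>v::pt. \<phi> ((norm v)\<^sup>2))"
      "continuous_on UNIV (\<lambda>v::pt. \<phi>' ((norm v)\<^sup>2))"
    using \<phi>(2)
    by (auto intro!: continuous_on_compose2[of UNIV _ UNIV "\<lambda>v. (norm v)\<^sup>2"] continuous_intros)
  then have cont_X: "continuous_on UNIV X"
    unfolding X_def using hol
    by (intro continuous_intros holo3_continuous_on continuous_on_divergence
        coordinatewise_holo3_continuous_on)
  have X_eq_0: "X v = 0" if "v \<notin> shell" for v
  proof -
    have "\<phi> ((norm v)\<^sup>2) = 0 \<and> \<phi>' ((norm v)\<^sup>2) = 0" using that by (intro \<phi>(3)) (auto simp: shell_def)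
    then show ?thesis by (simp add: X_def)
  qed
  have [measurable]: "f \<in> borel_measurable borel" "X \<in> borel_measurable borel"
    using cont_f cont_X by (auto intro: borel_measurable_continuous_onI)
  have int: "integrable lborel (\<lambda>v. of_real (norm (f v) powr (- 2 * s)) * X v)"
    by (rule integrable_weight_if_support[OF compact_shell cont_f cont_X X_eq_0 fin])
  have ae: "AE v in lborel. X v \<noteq> 0 \<longrightarrow> f v \<noteq> 0"
    using AE_nonzero_if_weight_finite[OF \<open>f \<in> _\<close> sets_borel_shell fin]
    by eventually_elim (use X_eq_0 in auto)
  have "(\<integral>v. of_real (((norm (f v))\<^sup>2 + 1 / real (Suc n)) powr (- s)) * X v \<partial>lborel) = 0" for n
    unfolding X_def
  proof (rule integral_divergence_smooth_weight_eq_0[OF hol syz _ _ \<phi>(1,2)])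
    show "((\<lambda>t. (t + 1 / real (Suc n)) powr (- s)) has_real_derivative
        (- s) * (t + 1 / real (Suc n)) powr (- s - 1)) (at t)" if "t \<ge> 0" for t
      using that by (auto intro!: derivative_eq_intros simp: add_nonneg_pos)
    show "continuous_on {0..} (\<lambda>t. (- s) * (t + 1 / real (Suc n)) powr (- s - 1))"
      by (intro continuous_intros) (auto simp: add_nonneg_eq_0_iff)
  qed (use \<phi>(3) in auto)
  then have "(\<integral>v. of_real (norm (f v) powr (- 2 * s)) * X v \<partial>lborel) = 0"
    using integral_regularized_weight_tendsto[OF _ _ s int ae] by (simp add: LIMSEQ_const_iff)
  then show ?thesis unfolding X_def .
qed

subsection \<open>Radial cutoffs and dilations\<close>

lemma DERIV_max_0_squared: "((\<lambda>t::real. (max 0 t)\<^sup>2) has_real_derivative 2 * max 0 t) (at t)"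
proof -
  consider "t > 0" | "t < 0" | "t = 0" by linarith
  then show ?thesis
  proof cases
    case 1
    have "((\<lambda>t::real. t\<^sup>2) has_real_derivative 2 * t) (at t)" by (auto intro!: derivative_eq_intros)
    then have "((\<lambda>t::real. (max 0 t)\<^sup>2) has_real_derivative 2 * t) (at t)"
      by (rule has_field_derivative_transform_within_open[of _ _ _ "{0<..}"]) (use 1 in auto)
    then show ?thesis using 1 by simp
  next
    case 2
    have "((\<lambda>t::real. 0) has_real_derivative 0) (at t)" by simp
    then have "((\<lambda>t::real. (max 0 t)\<^sup>2) has_real_derivative 0) (at t)"
      by (rule has_field_derivative_transform_within_open[of _ _ _ "{..<0}"]) (use 2 in auto)
    then show ?thesis using 2 by simp
  next
    case 3
    have "norm ((max 0 h)\<^sup>2 / h) \<le> \<bar>h\<bar>" for h :: real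
      by (cases "h > 0") (auto simp: power2_eq_square max_def)
    then have "((\<lambda>h::real. (max 0 h)\<^sup>2 / h) \<longlongrightarrow> 0) (at 0)"
      by (rule Lim_null_comparison[OF always_eventually[OF allI]
            tendsto_rabs_zero[OF tendsto_ident_at]])
    then show ?thesis using 3 by (simp add: DERIV_def)
  qed
qed

definition step :: "real \<Rightarrow> real" where
  "step t = (max 0 (t - 1))\<^sup>2 - 2 * (max 0 (t - 3 / 2))\<^sup>2 + (max 0 (t - 2))\<^sup>2"

definition step' :: "real \<Rightarrow> real" where
  "step' t = 2 * max 0 (t - 1) - 4 * max 0 (t - 3 / 2) + 2 * max 0 (t - 2)"

lemma DERIV_step: "(step has_real_derivative step' t) (at t)"
proof -
  have "((\<lambda>t. (max 0 (t - c))\<^sup>2) has_real_derivative 2 * max 0 (t - c)) (at t)" for c :: real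
    by (rule DERIV_cong[OF DERIV_chain2[OF DERIV_max_0_squared]])
        (auto intro!: derivative_eq_intros)
  from DERIV_add[OF DERIV_diff[OF this DERIV_cmult[OF this]] this] show ?thesis
    unfolding step_def[abs_def] step'_def by (rule DERIV_cong) simp
qed

lemma continuous_on_step': "continuous_on S step'"
  unfolding step'_def[abs_def] by (intro continuous_intros)

lemma step_eq:
  shows "t \<le> 1 \<Longrightarrow> step t = 0" "t \<ge> 2 \<Longrightarrow> step t = 1 / 2"
    and "t \<le> 1 \<Longrightarrow> step' t = 0" "t \<ge> 2 \<Longrightarrow> step' t = 0"
  by (simp_all add: step_def step'_def power2_eq_square algebra_simps)

lemma step_bounds: "0 \<le> step t" "step t \<le> 1 / 2"
proof -
  consider "t \<le> 1" | "1 \<le> t" "t \<le> 3 / 2" | "3 / 2 \<le> t" "t \<le> 2" | "2 \<le> t" by linarith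
  then have "0 \<le> step t \<and> step t \<le> 1 / 2"
  proof cases
    case 2
    then have "step t = (t - 1)\<^sup>2" by (simp add: step_def)
    moreover have "(t - 1)\<^sup>2 \<le> (1 / 2)\<^sup>2" using 2 by (intro power_mono) auto
    ultimately show ?thesis by (simp add: power2_eq_square)
  next
    case 3
    then have "step t = 1 / 2 - (2 - t)\<^sup>2" by (simp add: step_def power2_eq_square algebra_simps)
    moreover have "(2 - t)\<^sup>2 \<le> (1 / 2)\<^sup>2" using 3 by (intro power_mono) auto
    ultimately show ?thesis by (simp add: power2_eq_square)
  qed (simp_all add: step_eq)
  then show "0 \<le> step t" "step t \<le> 1 / 2" by auto
qed

text \<open>Up to a constant factor, the dilation \<open>v \<mapsto> 2 v\<close> turns the second term of \<open>bump (|v|\<^sup>2)\<close> and of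
  \<open>bump' (|v|\<^sup>2)\<close> into the first.\<close>

definition bump :: "real \<Rightarrow> real" where
  "bump t = step (4 * t) - step t"

definition bump' :: "real \<Rightarrow> real" where
  "bump' t = 4 * step' (4 * t) - step' t"

lemma DERIV_bump: "(bump has_real_derivative bump' t) (at t)"
proof -
  have "((\<lambda>t. step (4 * t)) has_real_derivative step' (4 * t) * 4) (at t)"
    by (rule DERIV_chain2[OF DERIV_step]) (auto intro!: derivative_eq_intros)
  from DERIV_diff[OF this DERIV_step] show ?thesis
    by (simp add: bump_def[abs_def] bump'_def mult.commute)
qed

lemma continuous_on_bump: "continuous_on S bump"
  by (intro continuous_at_imp_continuous_on ballI DERIV_isCont[OF DERIV_bump])

lemma continuous_on_bump': "continuous_on S bump'"
  unfolding bump'_def[abs_def]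
  by (intro continuous_intros continuous_on_step'
      continuous_on_compose2[OF continuous_on_step'[of UNIV]]) auto

lemma bump_eq_0: "t \<ge> 4 \<or> t \<le> 1 / 4 \<Longrightarrow> bump t = 0 \<and> bump' t = 0"
  by (auto simp: bump_def bump'_def step_eq)

lemma bump_nonneg: "0 \<le> bump t"
  using step_bounds[of t] step_bounds[of "4 * t"]
  by (cases "t \<le> 1") (simp_all add: bump_def step_eq)

lemma bump_pos: "1 / 2 \<le> t \<Longrightarrow> t \<le> 1 \<Longrightarrow> 0 < bump t"
  by (simp add: bump_def step_eq)

lemma continuous_on_divide_id:
  fixes k :: "real \<Rightarrow> real"
  assumes k: "continuous_on UNIV k" and c: "c > 0" "\<And>t. t \<le> c \<Longrightarrow> k t = 0"
  shows "continuous_on UNIV (\<lambda>t. k t / t)"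
proof -
  have "continuous_on UNIV (\<lambda>t. k t / max t c)"
    using c(1) by (intro continuous_intros k) auto
  also have "(\<lambda>t. k t / max t c) = (\<lambda>t. k t / t)"
  proof
    fix t show "k t / max t c = k t / t" using c(2)[of t] by (cases "t \<le> c") auto
  qed
  finally show ?thesis .
qed

lemma DERIV_divide_id:
  fixes k :: "real \<Rightarrow> real"
  assumes k: "(k has_real_derivative k') (at t)" and c: "c > 0" "\<And>t. t \<le> c \<Longrightarrow> k t = 0"
  shows "((\<lambda>t. k t / t) has_real_derivative (k' / t - k t / t / t)) (at t)"
proof (cases "t < c")
  case True
  have zero: "((\<lambda>t::real. 0) has_real_derivative 0) (at t)" by simp
  have "(k has_real_derivative 0) (at t)" "((\<lambda>t. k t / t) has_real_derivative 0) (at t)"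
    by (rule has_field_derivative_transform_within_open[OF zero, of "{..<c}"];
        use True c(2) in auto)+
  then show ?thesis using DERIV_unique[OF k] c(2)[of t] True by auto
next
  case False
  then have "t \<noteq> 0" using c(1) by auto
  then show ?thesis by (auto intro!: derivative_eq_intros k simp: field_simps)
qed

definition bump_over :: "real \<Rightarrow> real" where
  "bump_over t = bump t / t"

definition bump_over' :: "real \<Rightarrow> real" where
  "bump_over' t = bump' t / t - bump t / t / t"

lemma DERIV_bump_over: "(bump_over has_real_derivative bump_over' t) (at t)"
  unfolding bump_over_def[abs_def] bump_over'_def
  by (rule DERIV_divide_id[OF DERIV_bump, of "1 / 4"]) (use bump_eq_0 in auto)

lemma continuous_on_bump_over: "continuous_on UNIV bump_over"
  by (intro continuous_at_imp_continuous_on ballI DERIV_isCont[OF DERIV_bump_over])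

lemma continuous_on_bump_over': "continuous_on UNIV bump_over'"
proof -
  have "continuous_on UNIV (\<lambda>t. bump' t / t)"
    by (rule continuous_on_divide_id[OF continuous_on_bump', of "1 / 4"]) (use bump_eq_0 in auto)
  moreover have "continuous_on UNIV (\<lambda>t. bump_over t / t)"
    by (rule continuous_on_divide_id[OF continuous_on_bump_over, of "1 / 4"])
       (use bump_eq_0 in \<open>auto simp: bump_over_def\<close>)
  ultimately show ?thesis
    unfolding bump_over'_def[abs_def] bump_over_def by (rule continuous_on_diff)
qed

lemma bump_over_eq_0: "t \<ge> 4 \<or> t \<le> 1 / 4 \<Longrightarrow> bump_over t = 0 \<and> bump_over' t = 0"
  using bump_eq_0[of t] by (simp add: bump_over_def bump_over'_def)

lemma lborel_integral_dilation:
  fixes F :: "'a::euclidean_space \<Rightarrow> 'b::{banach, second_countable_topology}"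
  assumes [measurable]: "F \<in> borel_measurable borel" and c: "c \<noteq> 0"
  shows "(\<integral>v. F v \<partial>lborel) = \<bar>c\<bar> ^ DIM('a) *\<^sub>R (\<integral>v. F (c *\<^sub>R v) \<partial>lborel)"
proof -
  have "(\<integral>v. F v \<partial>lborel)
      = (\<integral>v. F v \<partial>density (distr lborel borel (\<lambda>x::'a. 0 + c *\<^sub>R x)) (\<lambda>_. ennreal (\<bar>c\<bar> ^ DIM('a))))"
    using lborel_affine[OF c, of "0::'a"] by simp
  also have "\<dots> = (\<integral>v. \<bar>c\<bar> ^ DIM('a) *\<^sub>R F v \<partial>distr lborel borel (\<lambda>x::'a. 0 + c *\<^sub>R x))"
    by (subst integral_density) auto
  also have "\<dots> = (\<integral>v. \<bar>c\<bar> ^ DIM('a) *\<^sub>R F (0 + c *\<^sub>R v) \<partial>lborel)"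
    by (rule integral_distr) auto
  finally show ?thesis by simp
qed

lemma integrable_mult_radial_cutoff:
  fixes A :: "pt \<Rightarrow> complex" and \<theta> :: "real \<Rightarrow> real"
  assumes A: "set_integrable lborel shell A"
    and \<theta>: "continuous_on UNIV \<theta>" "\<And>t. t \<ge> 4 \<or> t \<le> 1 / 4 \<Longrightarrow> \<theta> t = 0"
  shows "integrable lborel (\<lambda>v. A v * of_real (\<theta> ((norm v)\<^sup>2)))"
proof -
  have [measurable]: "\<theta> \<in> borel_measurable borel"
    using \<theta>(1) by (rule borel_measurable_continuous_onI)
  have int: "integrable lborel (\<lambda>v. indicator shell v *\<^sub>R A v)"
    using A by (simp add: set_integrable_def)
  note [measurable] = borel_measurable_integrable[OF int]
  have "bounded (\<theta> ` {1 / 4..4})"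
    by (intro compact_imp_bounded compact_continuous_image continuous_on_subset[OF \<theta>(1)]) auto
  then obtain M where M: "\<forall>t\<in>{1 / 4..4}. \<bar>\<theta> t\<bar> \<le> M" unfolding bounded_iff by auto
  have "integrable lborel (\<lambda>v. (indicator shell v *\<^sub>R A v) * of_real (\<theta> ((norm v)\<^sup>2)))"
  proof (rule Bochner_Integration.integrable_bound[OF integrable_mult_left[OF int, of "of_real M"]])
    show "AE v in lborel. norm ((indicator shell v *\<^sub>R A v) * of_real (\<theta> ((norm v)\<^sup>2)))
        \<le> norm ((indicator shell v *\<^sub>R A v) * of_real M)"
    proof (rule AE_I2)
      fix v
      show "norm ((indicator shell v *\<^sub>R A v) * of_real (\<theta> ((norm v)\<^sup>2)))
          \<le> norm ((indicator shell v *\<^sub>R A v) * of_real M)"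
        using bspec[OF M, of "(norm v)\<^sup>2"]
        by (cases "v \<in> shell") (auto simp: shell_def norm_mult intro!: mult_left_mono)
    qed
  qed measurable
  also have "(\<lambda>v. (indicator shell v *\<^sub>R A v) * of_real (\<theta> ((norm v)\<^sup>2)))
      = (\<lambda>v. A v * of_real (\<theta> ((norm v)\<^sup>2)))"
    using \<theta>(2) by (auto simp: fun_eq_iff indicator_def shell_def)
  finally show ?thesis .
qed

lemma integral_bump'_eq_0:
  fixes B :: "pt \<Rightarrow> complex"
  assumes [measurable]: "B \<in> borel_measurable borel" and B: "set_integrable lborel shell B"
    and dilate: "\<And>v. B (2 *\<^sub>R v) = B v / 16"
  shows "(\<integral>v. B v * of_real (bump' ((norm v)\<^sup>2)) \<partial>lborel) = 0"
proof -
  have [measurable]: "step' \<in> borel_measurable borel"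
    by (rule borel_measurable_continuous_onI) (rule continuous_on_step')
  have "integrable lborel (\<lambda>v. B v * of_real (step' ((norm v)\<^sup>2)))"
    by (rule integrable_mult_radial_cutoff[OF B continuous_on_step']) (auto simp: step_eq)
  moreover have "integrable lborel (\<lambda>v. B v * of_real (step' (4 * (norm v)\<^sup>2)))"
    by (rule integrable_mult_radial_cutoff[OF B, where \<theta> = "\<lambda>t. step' (4 * t)"])
       (auto simp: step_eq
         intro!: continuous_on_compose2[OF continuous_on_step'[of UNIV]] continuous_intros)
  moreover have "(\<integral>v. B v * of_real (step' ((norm v)\<^sup>2)) \<partial>lborel)
      = 64 * (\<integral>v. B (2 *\<^sub>R v) * of_real (step' ((norm (2 *\<^sub>R v))\<^sup>2)) \<partial>lborel)"
    by (subst lborel_integral_dilation[where c = 2]) (simp_all add: scaleR_conv_of_real)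
  then have "(\<integral>v. B v * of_real (step' ((norm v)\<^sup>2)) \<partial>lborel)
      = 4 * (\<integral>v. B v * of_real (step' (4 * (norm v)\<^sup>2)) \<partial>lborel)"
    by (simp add: dilate power_mult_distrib)
  moreover have "(\<lambda>v. B v * of_real (bump' ((norm v)\<^sup>2)))
      = (\<lambda>v. 4 * (B v * of_real (step' (4 * (norm v)\<^sup>2))) - B v * of_real (step' ((norm v)\<^sup>2)))"
    by (simp add: fun_eq_iff bump'_def algebra_simps)
  ultimately show ?thesis by simp
qed

lemma integral_bump_eq_0:
  fixes A B :: "pt \<Rightarrow> complex"
  assumes A: "set_integrable lborel shell A"
    and B: "set_integrable lborel shell B" "B \<in> borel_measurable borel"
    and dilate: "\<And>v. B (2 *\<^sub>R v) = B v / 16"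
    and int: "(\<integral>v. A v * of_real (bump ((norm v)\<^sup>2)) + B v * of_real (bump' ((norm v)\<^sup>2)) \<partial>lborel) = 0"
  shows "(\<integral>v. A v * of_real (bump ((norm v)\<^sup>2)) \<partial>lborel) = 0"
proof -
  have "integrable lborel (\<lambda>v. A v * of_real (bump ((norm v)\<^sup>2)))"
    "integrable lborel (\<lambda>v. B v * of_real (bump' ((norm v)\<^sup>2)))"
    using bump_eq_0
    by (auto intro: integrable_mult_radial_cutoff A B continuous_on_bump continuous_on_bump')
  then show ?thesis using int integral_bump'_eq_0[OF B(2,1) dilate] by simp
qed

lemma continuous_AE_eq_0_imp_eq_0:
  fixes k :: "'a::euclidean_space \<Rightarrow> 'b::t1_space"
  assumes S: "open S" and k: "continuous_on S k" and ae: "AE v in lborel. v \<in> S \<longrightarrow> k v = c"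
    and v: "v \<in> S"
  shows "k v = c"
proof -
  have "open (S \<inter> k -` (- {c}))" using S k by (intro continuous_open_preimage) auto
  then have closed: "closed (- (S \<inter> k -` (- {c})))" by (simp only: open_closed)
  have "AE x in lebesgue. x \<in> S \<longrightarrow> x \<in> - (S \<inter> k -` (- {c}))"
    using AE_completion[OF ae] by eventually_elim auto
  from mem_closed_if_AE_lebesgue_open[OF S closed this v] show ?thesis using v by auto
qed

lemma eq_0_if_eq_0_on_annulus:
  fixes k :: "'a::real_normed_vector \<Rightarrow> 'b::zero"
  assumes scale: "\<And>t v. 0 < t \<Longrightarrow> k (t *\<^sub>R v) = 0 \<Longrightarrow> k v = 0"
    and annulus: "\<And>v. 1 / 2 < (norm v)\<^sup>2 \<Longrightarrow> (norm v)\<^sup>2 < 1 \<Longrightarrow> k v = 0" and v: "v \<noteq> 0"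
  shows "k v = 0"
proof (rule scale)
  have "(norm ((sqrt (3 / 4) / norm v) *\<^sub>R v))\<^sup>2 = 3 / 4" using v by simp
  then show "k ((sqrt (3 / 4) / norm v) *\<^sub>R v) = 0" by (intro annulus) (simp_all del: norm_scaleR)
qed (use v in simp)

subsection \<open>Homogeneous syzygies of small degree\<close>

text \<open>The exponent \<open>s = (r + 2) / m\<close> makes the boundary terms of both integrations by parts
  invariant under dilations.\<close>

locale homogeneous_syzygy =
  fixes f :: "pt \<Rightarrow> complex" and \<delta> :: "pt \<Rightarrow> pt" and m r :: nat and s :: real
  assumes f: "holo3 f" "homogeneous m f"
    and \<delta>: "coordinatewise polyfun \<delta>" "coordinatewise (homogeneous r) \<delta>"
    and syzygy: "grad f v \<odot> \<delta> v = 0"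
    and s_nonneg: "0 \<le> s" and s_times_m: "s * real m = real (r + 2)"
    and weight_finite: "(\<integral>\<^sup>+x\<in>shell. weight (2 * s) (f x) \<partial>lborel) < \<infinity>"
begin

definition W :: "pt \<Rightarrow> real" where
  "W v = norm (f v) powr (- 2 * s)"

definition radial :: "pt \<Rightarrow> complex" where
  "radial v = \<delta> v \<odot> cnj3 v"

lemma holo3_\<delta>: "coordinatewise holo3 \<delta>"
  using \<delta>(1) polyfun_holo3 by (rule coordinatewise_mono)

lemma \<delta>_scaleR: "\<delta> (t *\<^sub>R v) = (t ^ r) *\<^sub>R \<delta> v"
  using coordinatewise_homogeneousD[OF \<delta>(2), of "of_real t" v]
  by (simp add: scl_of_real flip: of_real_power)

lemma continuous_on_radial: "continuous_on S radial"
  unfolding radial_def[abs_def]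
  by (intro continuous_intros coordinatewise_holo3_continuous_on holo3_\<delta>)

lemma radial_dilate: "radial (2 *\<^sub>R v) = 2 ^ (r + 1) * radial v"
proof -
  have "2 *\<^sub>R v = scl 2 v" using scl_of_real[of 2 v] by simp
  then show ?thesis by (simp add: radial_def coordinatewise_homogeneousD[OF \<delta>(2)])
qed

lemma W_dilate: "W (2 *\<^sub>R v) = W v / 4 ^ (r + 2)"
proof -
  have "norm (f (2 *\<^sub>R v)) = 2 ^ m * norm (f v)"
    using homogeneousD[OF f(2), of 2 v] scl_of_real[of 2 v] by (simp add: norm_mult norm_power)
  then have "W (2 *\<^sub>R v) = ((2::real) ^ m) powr (- 2 * s) * W v"
    by (simp add: W_def powr_mult)
  also have "((2::real) ^ m) powr (- 2 * s) = 2 powr (2 * - (s * real m))"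
    by (simp add: powr_realpow[symmetric] powr_powr mult_ac)
  also have "\<dots> = 4 powr - (s * real m)" using powr_powr[of 2 2 "- (s * real m)"] by simp
  also have "\<dots> = 1 / 4 ^ (r + 2)"
    unfolding s_times_m by (simp only: powr_minus_divide powr_realpow zero_less_numeral)
  finally show ?thesis by simp
qed

lemma set_integrable_W:
  fixes X :: "pt \<Rightarrow> complex"
  shows "continuous_on shell X \<Longrightarrow> set_integrable lborel shell (\<lambda>v. of_real (W v) * X v)"
  unfolding W_def
  by (rule set_integrable_weight[OF compact_shell holo3_continuous_on[OF f(1)] _ weight_finite])

lemma borel_measurable_W [measurable]: "W \<in> borel_measurable borel"
  using borel_measurable_continuous_onI[OF holo3_continuous_on[OF f(1)]] unfolding W_def
  by measurable

lemma AE_f_nonzero: "AE v in lborel. v \<in> shell \<longrightarrow> f v \<noteq> 0"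
  by (rule AE_nonzero_if_weight_finite[OF _ sets_borel_shell weight_finite])
     (intro borel_measurable_continuous_onI holo3_continuous_on f)

lemma integration_by_parts:
  assumes hol: "holo3 l" "holo3 g"
    and \<phi>: "\<And>t. (\<phi> has_real_derivative \<phi>' t) (at t)" "continuous_on UNIV \<phi>'"
      "\<And>t. t \<ge> 4 \<or> t \<le> 1 / 4 \<Longrightarrow> \<phi> t = 0 \<and> \<phi>' t = 0"
  shows "(\<integral>v. of_real (W v) *
    (cnj (g v) * ((l v * divergence \<delta> v + grad l v \<odot> \<delta> v) * of_real (\<phi> ((norm v)\<^sup>2)) +
      l v * radial v * of_real (\<phi>' ((norm v)\<^sup>2)))) \<partial>lborel) = 0"
proof -
  have "grad f v \<odot> scl (l v) (\<delta> v) = 0" for v by (simp add: syzygy)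
  from integral_divergence_weight_eq_0[OF coordinatewise_holo3_scl[OF hol(1) holo3_\<delta>]
      f(1) hol(2) this \<phi> s_nonneg weight_finite]
  show ?thesis by (simp add: W_def radial_def divergence_scl[OF hol(1) holo3_\<delta>])
qed

lemma eq_0_if_integral_bump_eq_0:
  fixes k :: "pt \<Rightarrow> real"
  assumes k: "continuous_on shell k" "\<And>v. 0 \<le> k v"
    and int: "(\<integral>v. of_real (W v) * of_real (k v) * of_real (bump ((norm v)\<^sup>2)) \<partial>lborel)
        = (0::complex)"
    and v: "1 / 2 < (norm v)\<^sup>2" "(norm v)\<^sup>2 < 1"
  shows "k v = 0"
proof -
  define T where "T v = W v * k v * bump ((norm v)\<^sup>2)" for v
  have "integrable lborel (\<lambda>v. of_real (W v) * of_real (k v) * complex_of_real (bump ((norm v)\<^sup>2)))"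
    using bump_eq_0
    by (intro integrable_mult_radial_cutoff set_integrable_W continuous_on_of_real k(1)
        continuous_on_bump) auto
  then have "integrable lborel T"
    unfolding T_def of_real_mult[symmetric] complex_of_real_integrable_eq .
  moreover have "(\<integral>v. T v \<partial>lborel) = 0"
    using int unfolding T_def of_real_mult[symmetric] integral_complex_of_real by simp
  moreover have "0 \<le> T v" for v using k(2) bump_nonneg by (simp add: T_def W_def)
  ultimately have "AE v in lborel. T v = 0"
    using integral_nonneg_eq_0_iff_AE by blast
  then have ae: "AE v in lborel. v \<in> {v. 1 / 2 < (norm v)\<^sup>2 \<and> (norm v)\<^sup>2 < 1} \<longrightarrow> k v = 0"
    using AE_f_nonzero
  proof eventually_elim
    case (elim v)
    then show ?case using bump_pos[of "(norm v)\<^sup>2"] by (auto simp: T_def W_def shell_def)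
  qed
  show ?thesis
  proof (rule continuous_AE_eq_0_imp_eq_0[OF _ continuous_on_subset[OF k(1)] ae])
    show "open {v::pt. 1 / 2 < (norm v)\<^sup>2 \<and> (norm v)\<^sup>2 < 1}"
      by (intro open_Collect_conj open_Collect_less continuous_intros)
  qed (use v in \<open>auto simp: shell_def\<close>)
qed

lemma divergence_eq_0:
  assumes "v \<noteq> 0"
  shows "divergence \<delta> v = 0"
proof -
  define h where "h = divergence \<delta>"
  have h: "holo3 h" unfolding h_def by (intro polyfun_holo3 polyfun_divergence \<delta>)
  have h_dilate: "2 * h (2 *\<^sub>R v) = 2 ^ r * h v" for v
    using divergence_homogeneous[OF holo3_\<delta> \<delta>(2), of 2 v] scl_of_real[of 2 v] by (simp add: h_def)
  have cont_h: "continuous_on S h" for S by (rule holo3_continuous_on[OF h])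
  have "(\<integral>v. of_real (W v) * of_real ((norm (h v))\<^sup>2) * of_real (bump ((norm v)\<^sup>2)) \<partial>lborel)
      = (0::complex)"
  proof (rule integral_bump_eq_0)
    let ?B = "\<lambda>v. of_real (W v) * (cnj (h v) * radial v)"
    show "set_integrable lborel shell (\<lambda>v. complex_of_real (W v) * of_real ((norm (h v))\<^sup>2))"
      by (intro set_integrable_W continuous_intros cont_h)
    show "set_integrable lborel shell ?B"
      by (intro set_integrable_W continuous_intros cont_h continuous_on_radial)
    have "(\<lambda>v. cnj (h v) * radial v) \<in> borel_measurable borel"
      by (intro borel_measurable_continuous_onI continuous_intros cont_h continuous_on_radial)
    then show "?B \<in> borel_measurable borel" by measurable
    show "?B (2 *\<^sub>R v) = ?B v / 16" for v
    proof -
      have "2 * (cnj (h (2 *\<^sub>R v)) * radial (2 *\<^sub>R v)) = cnj (2 * h (2 *\<^sub>R v)) * radial (2 *\<^sub>R v)"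
        by simp
      also have "\<dots> = 2 * ((2 * 2) ^ r * (cnj (h v) * radial v))"
        unfolding h_dilate radial_dilate power_mult_distrib by simp
      finally show ?thesis by (simp add: W_dilate)
    qed
    show "(\<integral>v. of_real (W v) * of_real ((norm (h v))\<^sup>2) * of_real (bump ((norm v)\<^sup>2)) +
        ?B v * of_real (bump' ((norm v)\<^sup>2)) \<partial>lborel) = 0"
      using integration_by_parts[OF holo3_const(1)[of 1] h DERIV_bump continuous_on_bump' bump_eq_0]
      unfolding complex_norm_square by (simp add: holo3_const h_def algebra_simps)
  qed
  then have "h v = 0" if "1 / 2 < (norm v)\<^sup>2" "(norm v)\<^sup>2 < 1" for v
    using eq_0_if_integral_bump_eq_0[of "\<lambda>v. (norm (h v))\<^sup>2" v] that
    by (simp add: continuous_intros cont_h)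
  moreover have "h v = 0" if "0 < t" "h (t *\<^sub>R v) = 0" for t v
    using divergence_homogeneous[OF holo3_\<delta> \<delta>(2), of "of_real t" v] that
    by (simp add: h_def scl_of_real)
  ultimately show ?thesis using eq_0_if_eq_0_on_annulus[of h v] assms by (simp add: h_def)
qed

lemma integration_by_parts_bump_over:
  assumes k: "holo3 k" and l: "holo3 l" "\<And>v. grad l v \<odot> \<delta> v = k v"
  defines "Y \<equiv> \<lambda>v. of_real (W v) * (cnj (k v) * (k v * of_real (bump_over ((norm v)\<^sup>2)) +
    l v * radial v * of_real (bump_over' ((norm v)\<^sup>2))))"
  shows "integrable lborel Y" "(\<integral>v. Y v \<partial>lborel) = 0"
proof -
  have "integrable lborel (\<lambda>v. of_real (W v) * (cnj (k v) * k v) * of_real (bump_over ((norm v)\<^sup>2)) +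
      of_real (W v) * (cnj (k v) * l v * radial v) * of_real (bump_over' ((norm v)\<^sup>2)))"
    using bump_over_eq_0
    by (intro Bochner_Integration.integrable_add integrable_mult_radial_cutoff set_integrable_W
        continuous_intros holo3_continuous_on k l continuous_on_radial
        continuous_on_bump_over continuous_on_bump_over') auto
  then show "integrable lborel Y" by (simp add: Y_def algebra_simps)
  have "Y = (\<lambda>v. of_real (W v) * (cnj (k v) * ((l v * divergence \<delta> v + grad l v \<odot> \<delta> v) *
      of_real (bump_over ((norm v)\<^sup>2)) + l v * radial v * of_real (bump_over' ((norm v)\<^sup>2)))))"
  proof
    fix v
    show "Y v = of_real (W v) * (cnj (k v) * ((l v * divergence \<delta> v + grad l v \<odot> \<delta> v) *
        of_real (bump_over ((norm v)\<^sup>2)) + l v * radial v * of_real (bump_over' ((norm v)\<^sup>2))))"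
      using divergence_eq_0[of v] bump_over_eq_0[of 0] by (cases "v = 0") (simp_all add: Y_def l(2))
  qed
  then show "(\<integral>v. Y v \<partial>lborel) = 0"
    using integration_by_parts[OF l(1) k DERIV_bump_over continuous_on_bump_over' bump_over_eq_0]
    by simp
qed

lemma integral_norm_squared_bump_over_eq_0:
  "(\<integral>v. complex_of_real (W v * ((norm (\<delta> v))\<^sup>2 * bump_over ((norm v)\<^sup>2) +
    (norm (radial v))\<^sup>2 * bump_over' ((norm v)\<^sup>2))) \<partial>lborel) = 0"
proof -
  define Y where "Y k l v = of_real (W v) * (cnj (k v) * (k v * of_real (bump_over ((norm v)\<^sup>2)) +
      l v * radial v * of_real (bump_over' ((norm v)\<^sup>2))))" for k l :: "pt \<Rightarrow> complex" and v
  have Y: "integrable lborel (Y k l)" "(\<integral>v. Y k l v \<partial>lborel) = 0"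
    if "holo3 k" "holo3 l" "\<And>v. grad l v \<odot> \<delta> v = k v" for k l
    unfolding Y_def[abs_def] using that by (rule integration_by_parts_bump_over)+
  have coords: "holo3 (\<lambda>v. px (\<delta> v))" "holo3 (\<lambda>v. py (\<delta> v))" "holo3 (\<lambda>v. pz (\<delta> v))"
    "grad px v \<odot> \<delta> v = px (\<delta> v)" "grad py v \<odot> \<delta> v = py (\<delta> v)" "grad pz v \<odot> \<delta> v = pz (\<delta> v)" for v
    using holo3_\<delta> by (auto simp: coordinatewise_def holo3_coordinates dot3_def)
  have "complex_of_real (W v
      * ((norm (\<delta> v))\<^sup>2 * bump_over ((norm v)\<^sup>2) + (norm (radial v))\<^sup>2 * bump_over' ((norm v)\<^sup>2)))
      = Y (\<lambda>v. px (\<delta> v)) px v + Y (\<lambda>v. py (\<delta> v)) py v + Y (\<lambda>v. pz (\<delta> v)) pz v" for v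
  proof -
    have "Y (\<lambda>v. px (\<delta> v)) px v + Y (\<lambda>v. py (\<delta> v)) py v + Y (\<lambda>v. pz (\<delta> v)) pz v =
        of_real (W v) * ((\<delta> v \<odot> cnj3 (\<delta> v)) * of_real (bump_over ((norm v)\<^sup>2)) +
          radial v * cnj (radial v) * of_real (bump_over' ((norm v)\<^sup>2)))"
      by (simp add: Y_def radial_def dot3_def algebra_simps)
    then show ?thesis by (simp add: dot3_cnj3_self flip: complex_norm_square)
  qed
  then show ?thesis using Y coords holo3_coordinates by simp
qed

lemma radial_bump_integral_eq_0:
  "(\<integral>v. of_real (W v) * of_real ((norm (\<delta> v))\<^sup>2 / (norm v)\<^sup>2 - (norm (radial v))\<^sup>2 / norm v ^ 4) *
    of_real (bump ((norm v)\<^sup>2)) \<partial>lborel) = (0::complex)"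
proof (rule integral_bump_eq_0)
  let ?A = "\<lambda>v. complex_of_real (W v)
      * of_real ((norm (\<delta> v))\<^sup>2 / (norm v)\<^sup>2 - (norm (radial v))\<^sup>2 / norm v ^ 4)"
  let ?B = "\<lambda>v. complex_of_real (W v) * of_real ((norm (radial v))\<^sup>2 / (norm v)\<^sup>2)"
  note cont = coordinatewise_holo3_continuous_on[OF holo3_\<delta>] continuous_on_radial
  show "set_integrable lborel shell ?A" "set_integrable lborel shell ?B"
    by (intro set_integrable_W continuous_intros cont; use shell_nonzero in simp)+
  have [measurable]: "radial \<in> borel_measurable borel"
    by (rule borel_measurable_continuous_onI[OF continuous_on_radial])
  show "?B \<in> borel_measurable borel" by measurable
  show "?B (2 *\<^sub>R v) = ?B v / 16" for v
  proof -
    have "(norm (radial (2 *\<^sub>R v)))\<^sup>2 = (2 * 2) ^ (r + 1) * (norm (radial v))\<^sup>2"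
      unfolding radial_dilate norm_mult power_mult_distrib
      by (simp add: norm_power power2_eq_square power_mult_distrib)
    then show ?thesis by (simp add: W_dilate power_mult_distrib)
  qed
  have "?A v * of_real (bump ((norm v)\<^sup>2)) + ?B v * of_real (bump' ((norm v)\<^sup>2)) = complex_of_real
      (W v * ((norm (\<delta> v))\<^sup>2 * bump_over ((norm v)\<^sup>2)
          + (norm (radial v))\<^sup>2 * bump_over' ((norm v)\<^sup>2)))" for v
    unfolding of_real_mult[symmetric] of_real_add[symmetric] of_real_eq_iff
      bump_over_def bump_over'_def
    by (simp add: algebra_simps power4_eq_xxxx power2_eq_square)
  then show "(\<integral>v. ?A v * of_real (bump ((norm v)\<^sup>2))
      + ?B v * of_real (bump' ((norm v)\<^sup>2)) \<partial>lborel) = 0"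
    using integral_norm_squared_bump_over_eq_0 by simp
qed

text \<open>\<open>radial v / |v|\<^sup>2\<close> times \<open>v\<close> is the orthogonal projection of \<open>\<delta> v\<close> to the line through \<open>v\<close>.\<close>

lemma norm_projection_residual_squared:
  "(norm ((norm v)\<^sup>2 *\<^sub>R \<delta> v - scl (radial v) v))\<^sup>2
    = (norm v)\<^sup>2 * ((norm v)\<^sup>2 * (norm (\<delta> v))\<^sup>2 - (norm (radial v))\<^sup>2)"
proof -
  have inner: "\<delta> v \<bullet> scl (radial v) v = (norm (radial v))\<^sup>2"
  proof -
    have "\<delta> v \<odot> cnj3 (scl (radial v) v) = cnj (radial v) * radial v"
      by (simp add: radial_def dot3_def algebra_simps)
    also have "\<dots> = of_real ((norm (radial v))\<^sup>2)" by (simp only: complex_norm_square mult.commute)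
    finally show ?thesis by (simp add: inner_eq_Re_dot3)
  qed
  have expand: "(norm (a *\<^sub>R x - y))\<^sup>2 = a\<^sup>2 * (norm x)\<^sup>2 - 2 * a * (x \<bullet> y) + (norm y)\<^sup>2"
    for a and x y :: pt
    unfolding power2_norm_eq_inner
    by (simp add: inner_diff_left inner_diff_right inner_commute[of y x] power2_eq_square
        algebra_simps)
  show ?thesis
    unfolding expand inner norm_scl by (simp add: power_mult_distrib power2_eq_square algebra_simps)
qed

lemma parallel_on_annulus:
  assumes v: "1 / 2 < (norm v)\<^sup>2" "(norm v)\<^sup>2 < 1"
  shows "(norm v)\<^sup>2 *\<^sub>R \<delta> v = scl (radial v) v"
proof -
  define k where "k v = (norm ((norm v)\<^sup>2 *\<^sub>R \<delta> v - scl (radial v) v))\<^sup>2 / norm v ^ 6" for v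
  have "k v = (norm (\<delta> v))\<^sup>2 / (norm v)\<^sup>2 - (norm (radial v))\<^sup>2 / norm v ^ 4" for v
  proof (cases "v = 0")
    case False
    then show ?thesis
      unfolding k_def norm_projection_residual_squared by (simp add: field_simps power_eq_if)
  qed (simp add: k_def)
  then have "(\<integral>v. of_real (W v) * of_real (k v) * of_real (bump ((norm v)\<^sup>2)) \<partial>lborel)
      = (0::complex)"
    using radial_bump_integral_eq_0 by simp
  moreover have "continuous_on shell k"
    unfolding k_def
    by (intro continuous_intros coordinatewise_holo3_continuous_on holo3_\<delta> continuous_on_radial)
       (use shell_nonzero in auto)
  moreover have "0 \<le> k v" for v by (simp add: k_def)
  ultimately have "k v = 0" using eq_0_if_integral_bump_eq_0 v by blast
  moreover have "norm v \<noteq> 0" using v by auto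
  ultimately show ?thesis by (simp add: k_def)
qed

theorem \<delta>_eq_0: "\<delta> v = 0"
proof -
  let ?S = "{v::pt. 1 / 2 < (norm v)\<^sup>2 \<and> (norm v)\<^sup>2 < 1}"
  note cont = coordinatewise_holo3_continuous_on[OF holo3_\<delta>]
  have m: "m \<noteq> 0" using s_times_m by (intro notI) simp
  have on_complement: "\<delta> v = 0" if v: "v \<in> ?S" "f v \<noteq> 0" for v
  proof -
    have par: "scl (of_real ((norm v)\<^sup>2)) (\<delta> v) = scl (radial v) v"
      using parallel_on_annulus[of v] v(1) unfolding scl_of_real by simp
    have "radial v * (of_nat m * f v) = grad f v \<odot> scl (radial v) v"
      by (simp add: euler_identity[OF f])
    also have "\<dots> = 0" by (simp add: syzygy flip: par)
    finally have "radial v = 0" using m v(2) by simp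
    then have "(norm v)\<^sup>2 *\<^sub>R \<delta> v = 0" using parallel_on_annulus[of v] v(1) by simp
    then show ?thesis using v(1) by auto
  qed
  have "AE v in lborel. v \<in> ?S \<longrightarrow> \<delta> v = 0"
    using AE_f_nonzero by eventually_elim (use on_complement in \<open>auto simp: shell_def\<close>)
  moreover have "open ?S" by (intro open_Collect_conj open_Collect_less continuous_intros)
  ultimately have "\<delta> v = 0" if "v \<in> ?S" for v
    using continuous_AE_eq_0_imp_eq_0[of ?S \<delta> 0] cont that by blast
  moreover have "\<delta> v = 0" if "0 < t" "\<delta> (t *\<^sub>R v) = 0" for t v using that by (simp add: \<delta>_scaleR)
  ultimately have off_origin: "\<delta> v = 0" if "v \<noteq> 0" for v
    using eq_0_if_eq_0_on_annulus[of \<delta> v] that by blast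
  have "AE v in lborel. v \<in> UNIV \<longrightarrow> \<delta> v = 0"
    using AE_lborel_singleton[of 0] by eventually_elim (use off_origin in blast)
  then show ?thesis using continuous_AE_eq_0_imp_eq_0[of UNIV \<delta> 0 v] cont by simp
qed

end

theorem syzygy_degree_ge:
  assumes f: "holo3 f" "homogeneous m f"
    and sing: "\<And>p. sing_point f p \<Longrightarrow> sing_type f p nf_A1 \<or> sing_type f p nf_A5 \<or> sing_type f p nf_D4"
    and \<delta>: "coordinatewise polyfun \<delta>" "coordinatewise (homogeneous r) \<delta>"
    and syz: "\<And>v. grad f v \<odot> \<delta> v = 0" and nonzero: "\<delta> v0 \<noteq> 0"
  shows "2 * m \<le> 3 * (r + 2)"
proof (rule ccontr)
  assume "\<not> 2 * m \<le> 3 * (r + 2)"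
  then have r: "3 * real (r + 2) < 2 * real m" by linarith
  define s where "s = real (r + 2) / real m"
  have s: "0 \<le> s" "s < 2 / 3" "s * real m = real (r + 2)"
    using r by (auto simp: s_def divide_simps)
  have "(\<integral>\<^sup>+x\<in>shell. weight (2 * s) (f x) \<partial>lborel) < \<infinity>"
    using weight_integrable_at_nonorigin[OF f s(1,2) sing]
    by (intro nn_integral_weight_compact_finite holo3_continuous_on f compact_shell)
        (use shell_nonzero in blast)
  then interpret homogeneous_syzygy f \<delta> m r s
    by unfold_locales (use f \<delta> syz s in auto)
  show False using \<delta>_eq_0 nonzero by simp
qed

lemma free_curve_syzygy:
  assumes "free_curve m f"
  obtains \<delta> r where "2 * r < m" "coordinatewise (homog r) \<delta>" "\<And>v. grad f v \<odot> \<delta> v = 0" "\<exists>v. \<delta> v \<noteq> 0"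
proof -
  obtain d1 d2 r1 r2 where d: "1 \<le> d1" "d1 \<le> d2" "d1 + d2 = m - 1"
    and r1: "r1 \<in> Syz f" "homog_syz d1 r1" and ne: "\<not> (\<exists>p. poly3 p \<and> r1 = smult_syz p r2)"
    using assms unfolding free_curve_def by blast
  obtain a b c where abc: "r1 = (a, b, c)" by (cases r1)
  define \<delta> where "\<delta> v = (a v, b v, c v)" for v
  have "\<exists>v. \<delta> v \<noteq> 0"
  proof (rule ccontr)
    assume "\<nexists>v. \<delta> v \<noteq> 0"
    then have "r1 = smult_syz (\<lambda>_. 0) r2"
      by (auto simp: \<delta>_def abc smult_syz_def fun_eq_iff zero_prod_def)
    moreover have "poly3 (\<lambda>_. 0)" unfolding poly3_def by (intro exI[of _ "\<lambda>_. 0"]) simp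
    ultimately show False using ne by blast
  qed
  moreover have "coordinatewise (homog d1) \<delta>"
    using r1(2) by (simp add: homog_syz_def abc coordinatewise_def \<delta>_def)
  moreover have "a v * dX f v + b v * dY f v + c v * dZ f v = 0" for v
    using r1(1) unfolding Syz_def abc by blast
  then have "grad f v \<odot> \<delta> v = 0" for v by (simp add: grad_def dot3_def \<delta>_def mult.commute)
  moreover have "2 * d1 < m" using d by linarith
  ultimately show ?thesis using that by blast
qed

theorem theorem3:
  fixes k d :: nat and E L :: "nat \<Rightarrow> pt \<Rightarrow> complex" and f :: "pt \<Rightarrow> complex"
  assumes "k \<ge> 1" and "d \<ge> 1"
    and "\<And>i. i < k \<Longrightarrow> smooth_cubic (E i)"
    and "\<And>j. j < d \<Longrightarrow> is_line (L j)"
    and "\<And>i i'. i < k \<Longrightarrow> i' < k \<Longrightarrow> i \<noteq> i' \<Longrightarrow> zeros (E i) \<noteq> zeros (E i')"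
    and "\<And>j j'. j < d \<Longrightarrow> j' < d \<Longrightarrow> j \<noteq> j' \<Longrightarrow> zeros (L j) \<noteq> zeros (L j')"
    and "\<And>i j. i < k \<Longrightarrow> j < d \<Longrightarrow> zeros (E i) \<noteq> zeros (L j)"
    and f_def: "f = (\<lambda>v. (\<Prod>i<k. E i v) * (\<Prod>j<d. L j v))"
    and "\<And>p. sing_point f p \<Longrightarrow>
           sing_type f p nf_A1 \<or> sing_type f p nf_A5 \<or> sing_type f p nf_D4"
    and "free_curve (3 * k + d) f"
  shows "3 * k + d \<le> 9"
proof -
  have E: "homog 3 (E i)" if "i < k" for i using assms(3)[OF that] by (simp add: smooth_cubic_def)
  have L: "homog 1 (L j)" if "j < d" for j using assms(4)[OF that] by (simp add: is_line_def)
  have "polyfun f"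
    unfolding f_def by (intro polyfun.mult polyfun_prod) (use E L homog_imp_polyfun in blast)+
  moreover have "homogeneous ((\<Sum>i<k. 3) + (\<Sum>j<d. 1)) f"
    unfolding f_def
    by (intro homogeneous_mult homogeneous_prod homog_imp_homogeneous) (use E L in blast)+
  then have "homogeneous (3 * k + d) f" by (simp add: mult.commute)
  moreover obtain \<delta> r v0 where \<delta>: "2 * r < 3 * k + d" "coordinatewise (homog r) \<delta>"
    "\<And>v. grad f v \<odot> \<delta> v = 0" "\<delta> v0 \<noteq> 0"
    using free_curve_syzygy[OF assms(10)] by metis
  ultimately have "2 * (3 * k + d) \<le> 3 * (r + 2)"
    using syzygy_degree_ge[OF polyfun_holo3 _ assms(9)] coordinatewise_mono[OF \<delta>(2)]
      homog_imp_polyfun homog_imp_homogeneous by metis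
  then show ?thesis using \<delta>(1) by presburger
qed

end
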